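(* Let $n\ge 2$, let $\bar A$ be an $n\times n$ real matrix satisfying $\|\bar A\|_2\le 1$, and let $A$ be a Gaussian perturbation of $\bar A$ of variance $\sigma^2\le 1$ (with $\sigma>0$). Then for every $x>0$, $$\Pr\left[\rho_U(A)>1+x\right]\le \sqrt{\frac{2}{\pi}}\,\frac1x\left(\frac23 n^{3/2}+\frac{n}{\sigma}+\frac43\,\frac{\sqrt n}{\sigma^2}\right).$$
   Context: $\|\cdot\|_2$ is the operator norm induced by the Euclidean norm; $\|\cdot\|_\infty$ of a matrix is the maximum absolute row sum. $A$ is a Gaussian perturbation of $\bar A$ of variance $\sigma^2$ if $A=\bar A+G$ where the entries of $G$ are independent Gaussian random variables with mean $0$ and standard deviation $\sigma$. With probability 1, $A$ has a unique LU-factorization (without pivoting) $A=LU$, where $L$ is lower-triangular with $1$s on the diagonal and $U$ is upper-triangular. The growth factor is $\rho_U(A)=\|U\|_\infty/\|A\|_\infty$. *)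

theory Defs
  imports "HOL-Probability.Probability"
begin

definition matrix_norm2 :: "real^'n^'m \<Rightarrow> real" where
  "matrix_norm2 A = onorm ((*v) A)"

definition matrix_norm_inf :: "real^'n^'m \<Rightarrow> real" where
  "matrix_norm_inf A = (MAX i. \<Sum>j\<in>UNIV. \<bar>A $ i $ j\<bar>)"

text \<open>
  The linear order on the finite index type plays the role of \<open>1 < 2 < \<dots> < n\<close>.
\<close>

definition unit_lower_triangular :: "real^'n::{finite,linorder}^'n::{finite,linorder} \<Rightarrow> bool" where
  "unit_lower_triangular L \<longleftrightarrow> (\<forall>i j. i < j \<longrightarrow> L $ i $ j = 0) \<and> (\<forall>i. L $ i $ i = 1)"

definition upper_triangular :: "real^'n::{finite,linorder}^'n::{finite,linorder} \<Rightarrow> bool" where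
  "upper_triangular U \<longleftrightarrow> (\<forall>i j. j < i \<longrightarrow> U $ i $ j = 0)"

definition lu_factorization ::
    "real^'n::{finite,linorder}^'n::{finite,linorder} \<Rightarrow> real^'n::{finite,linorder}^'n::{finite,linorder} \<Rightarrow> real^'n::{finite,linorder}^'n::{finite,linorder} \<Rightarrow> bool" where
  "lu_factorization A L U \<longleftrightarrow> unit_lower_triangular L \<and> upper_triangular U \<and> A = L ** U"

definition has_unique_lu :: "real^'n::{finite,linorder}^'n::{finite,linorder} \<Rightarrow> bool" where
  "has_unique_lu A \<longleftrightarrow> (\<exists>!LU. lu_factorization A (fst LU) (snd LU))"

definition lu_upper :: "real^'n::{finite,linorder}^'n::{finite,linorder} \<Rightarrow> real^'n::{finite,linorder}^'n::{finite,linorder}" where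
  "lu_upper A = (THE U. \<exists>L. lu_factorization A L U)"

text \<open>
  The value \<open>0\<close> for matrices without a unique LU-factorization is a convention. It is only
  used on a null set of matrices, and it keeps the growth factor a measurable function
  (an unguarded description operator is unspecified there, possibly differently for each matrix).
\<close>

definition growth_factor :: "real^'n::{finite,linorder}^'n::{finite,linorder} \<Rightarrow> real" where
  "growth_factor A =
     (if has_unique_lu A then matrix_norm_inf (lu_upper A) / matrix_norm_inf A else 0)"

text \<open>The parameter \<open>\<sigma>\<close> is the standard deviation, so the variance is \<open>\<sigma>\<^sup>2\<close>.\<close>

definition gaussian_perturbation ::
    "'w measure \<Rightarrow> real^'n^'m \<Rightarrow> real \<Rightarrow> ('w \<Rightarrow> real^'n^'m) \<Rightarrow> bool" where
  "gaussian_perturbation M Abar \<sigma> A \<longleftrightarrow>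
     (\<exists>G. (\<forall>\<omega>\<in>space M. A \<omega> = Abar + G \<omega>) \<and>
          prob_space.indep_vars M (\<lambda>_. borel) (\<lambda>(i, j) \<omega>. G \<omega> $ i $ j) UNIV \<and>
          (\<forall>i j. distributed M lborel (\<lambda>\<omega>. G \<omega> $ i $ j) (normal_density 0 \<sigma>)))"

end

(* Elimination gives U_kj = A_kj - sum_{i<k} y_i A_ij for j >= k, where y is the row k of A up to
   the diagonal times the inverse of the leading block. So rho_U > 1 + x forces, for some k,
   W_k = sum_{j>=k} |sum_{i<k} y_i A_ij| > x D, where D is the l1 norm of the last row.

   Fix the rows from k on, and let a be the part of row k before the diagonal. Rotate the rows of the
   leading block so that a becomes |a| e_1, and let t be a unit vector orthogonal to all columns of the
   rotated block but the first. Then y = |a| t / tau, where tau, the product of t with the first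
   column, is Gaussian and independent of t and of the columns from k on. The small ball estimate for tau gives
   P(W_k > x D) <= sqrt(2/pi) / (sigma x) E(|a| / D) sqrt(m (1 + m sigma^2)) with m = n - k + 1.

   For the last k, |a| <= D. For the others |a| and D are independent and E(1/D), the integral of the
   Laplace transform of D, is at most 16 / (9 sigma (n - 1)). By AM-GM,
   sqrt((1 + (k - 1) sigma^2) (1 + m sigma^2)) <= 1 + n sigma^2 / 2, so summing over k leaves sums of sqrt m. *)

theory Submission
  imports Defs "HOL-Real_Asymp.Real_Asymp"
begin

section \<open>Gaussian measures on Euclidean spaces\<close>

text \<open>The variable 1 / tau is not integrable, so Markov's inequality is of no use for W_k
  itself. Instead everything except tau is frozen, a small ball bound is applied to tau, and only
  the resulting threshold is averaged. That bound holds for every mean, so nothing has to be known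
  about the rotated mean of the first column. The norm bound on the mean matrix enters through row k
  and through the columns from k on; the rotation acts on the entries before k and leaves those
  columns unchanged.

  Independence is expressed by resampling: \<open>mix S x y\<close> takes the coordinates in
  \<open>S\<close> from an independent copy, so conditioning becomes an iterated integral. The last
  row is a good lower bound for the norm of A because it belongs to no leading block and stays
  frozen with row k.

  The constants are tuned to each other. The 16/9 comes from comparing a Gaussian with a uniform law
  of half width 9/8 sigma. The sum of sqrt m over the middle rows is at most 3/4 (n - 1) sqrt n. The
  factor n - 1 cancels, and 16/9 times 3/4 is 4/3; the summand n sigma^2 / 2 of the AM-GM bound
  turns it into 2/3.\<close>

definition gauss :: "'a::euclidean_space \<Rightarrow> real \<Rightarrow> 'a measure" where
  "gauss \<mu> \<sigma> = density lborel (\<lambda>x. \<Prod>b\<in>Basis. ennreal (normal_density (\<mu> \<bullet> b) \<sigma> (x \<bullet> b)))"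

lemma sets_gauss [simp, measurable_cong]: "sets (gauss \<mu> \<sigma>) = sets borel"
  by (simp add: gauss_def)

lemma space_gauss [simp]: "space (gauss \<mu> \<sigma>) = UNIV"
  by (simp add: gauss_def)

lemma nn_integral_gauss:
  assumes [measurable]: "h \<in> borel_measurable borel"
  shows "(\<integral>\<^sup>+x. h x \<partial>gauss \<mu> \<sigma>)
    = (\<integral>\<^sup>+x. (\<Prod>b\<in>Basis. ennreal (normal_density (\<mu> \<bullet> b) \<sigma> (x \<bullet> b))) * h x \<partial>lborel)"
  unfolding gauss_def by (rule nn_integral_density) measurable

lemma nn_integral_gauss_real:
  fixes \<mu> :: real
  assumes "h \<in> borel_measurable borel"
  shows "(\<integral>\<^sup>+x. h x \<partial>gauss \<mu> \<sigma>) = (\<integral>\<^sup>+x. ennreal (normal_density \<mu> \<sigma> x) * h x \<partial>lborel)"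
  using nn_integral_gauss[OF assms] by simp

lemma gauss_real:
  fixes \<mu> :: real
  shows "gauss \<mu> \<sigma> = density lborel (\<lambda>x. ennreal (normal_density \<mu> \<sigma> x))"
  by (simp add: gauss_def)

lemma nn_integral_gauss_prod:
  assumes [measurable]: "\<And>b. b \<in> Basis \<Longrightarrow> f b \<in> borel_measurable borel"
  shows "(\<integral>\<^sup>+x. (\<Prod>b\<in>Basis. f b (x \<bullet> b)) \<partial>gauss \<mu> \<sigma>)
    = (\<Prod>b\<in>Basis. \<integral>\<^sup>+y. f b y \<partial>gauss (\<mu> \<bullet> b) \<sigma>)"
proof -
  have "(\<integral>\<^sup>+x. (\<Prod>b\<in>Basis. f b (x \<bullet> b)) \<partial>gauss \<mu> \<sigma>)
    = (\<integral>\<^sup>+x. (\<Prod>b\<in>Basis. ennreal (normal_density (\<mu> \<bullet> b) \<sigma> (x \<bullet> b)) * f b (x \<bullet> b)) \<partial>lborel)"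
    by (simp add: nn_integral_gauss prod.distrib)
  also have "\<dots> = (\<Prod>b\<in>Basis. \<integral>\<^sup>+y. ennreal (normal_density (\<mu> \<bullet> b) \<sigma> y) * f b y \<partial>lborel)"
    by (rule nn_integral_lborel_prod) auto
  also have "\<dots> = (\<Prod>b\<in>Basis. \<integral>\<^sup>+y. f b y \<partial>gauss (\<mu> \<bullet> b) \<sigma>)"
    by (intro prod.cong refl) (simp add: nn_integral_gauss_real)
  finally show ?thesis .
qed

lemma prod_indicator_cylinder:
  fixes T :: "'a \<Rightarrow> 'b set"
  assumes "finite B"
  shows "(\<Prod>b\<in>B. indicator (T b) (g b)) = (if \<forall>b\<in>B. g b \<in> T b then 1 else (0::ennreal))"
  using assms by (induction B rule: finite_induct) (auto simp: indicator_def)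

lemma cylinder_sets [measurable]:
  fixes T :: "'a::euclidean_space \<Rightarrow> real set"
  assumes [measurable]: "\<And>b. b \<in> Basis \<Longrightarrow> T b \<in> sets borel"
  shows "{x. \<forall>b\<in>Basis. x \<bullet> b \<in> T b} \<in> sets borel"
proof -
  have "{x::'a. \<forall>b\<in>Basis. x \<bullet> b \<in> T b} = (\<Inter>b\<in>Basis. (\<lambda>x. x \<bullet> b) -` T b \<inter> space borel)"
    by auto
  also have "\<dots> \<in> sets borel"
    by (intro sets.finite_INT measurable_sets[where A=borel]) auto
  finally show ?thesis .
qed

lemma emeasure_gauss_cylinder:
  assumes [measurable]: "\<And>b. b \<in> Basis \<Longrightarrow> T b \<in> sets borel"
  shows "emeasure (gauss \<mu> \<sigma>) {x. \<forall>b\<in>Basis. x \<bullet> b \<in> T b}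
    = (\<Prod>b\<in>Basis. emeasure (gauss (\<mu> \<bullet> b) \<sigma>) (T b))"
proof -
  have "emeasure (gauss \<mu> \<sigma>) {x. \<forall>b\<in>Basis. x \<bullet> b \<in> T b}
      = (\<integral>\<^sup>+x. indicator {x. \<forall>b\<in>Basis. x \<bullet> b \<in> T b} x \<partial>gauss \<mu> \<sigma>)"
    by (rule nn_integral_indicator[symmetric]) (use assms in \<open>auto intro: cylinder_sets\<close>)
  also have "\<dots> = (\<integral>\<^sup>+x. (\<Prod>b\<in>Basis. indicator (T b) (x \<bullet> b)) \<partial>gauss \<mu> \<sigma>)"
    by (intro nn_integral_cong) (simp add: prod_indicator_cylinder indicator_def)
  also have "\<dots> = (\<Prod>b\<in>Basis. \<integral>\<^sup>+y. indicator (T b) y \<partial>gauss (\<mu> \<bullet> b) \<sigma>)"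
    by (rule nn_integral_gauss_prod) auto
  also have "\<dots> = (\<Prod>b\<in>Basis. emeasure (gauss (\<mu> \<bullet> b) \<sigma>) (T b))"
    by (intro prod.cong refl) simp
  finally show ?thesis .
qed

lemma prob_space_gauss_real: "\<sigma> > 0 \<Longrightarrow> prob_space (gauss (\<mu>::real) \<sigma>)"
  unfolding gauss_real by (rule prob_space_normal_density)

lemma prob_space_gauss:
  assumes "\<sigma> > 0"
  shows "prob_space (gauss \<mu> \<sigma>)"
proof
  have "emeasure (gauss (\<mu> \<bullet> b) \<sigma>) UNIV = 1" for b
    using prob_space.emeasure_space_1[OF prob_space_gauss_real[OF assms, of "\<mu> \<bullet> b"]] by simp
  with emeasure_gauss_cylinder[of "\<lambda>_. UNIV" \<mu> \<sigma>]
  show "emeasure (gauss \<mu> \<sigma>) (space (gauss \<mu> \<sigma>)) = 1"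
    by simp
qed

text \<open>Open boxes are cylinders, form an intersection-stable generator of the Borel sets and
  exhaust the space, so a measure is determined by its values on cylinders.\<close>

lemma gauss_eqI:
  fixes K :: "'a::euclidean_space measure"
  assumes "\<sigma> > 0" and sets: "sets K = sets borel"
    and eq: "\<And>T. (\<And>b. T b \<in> sets borel) \<Longrightarrow>
      emeasure K {x. \<forall>b\<in>Basis. x \<bullet> b \<in> T b} = (\<Prod>b\<in>Basis. emeasure (gauss (\<mu> \<bullet> b) \<sigma>) (T b))"
  shows "K = gauss \<mu> \<sigma>"
proof (rule sym, rule measure_eqI_generator_eq)
  let ?E = "range (\<lambda>(a, b). box a b::'a set)"
  interpret prob_space "gauss \<mu> \<sigma>"
    by (rule prob_space_gauss) fact
  show "Int_stable ?E"
    by (auto simp: Int_stable_def box_Int_box)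
  show "?E \<subseteq> Pow UNIV" "sets (gauss \<mu> \<sigma>) = sigma_sets UNIV ?E" "sets K = sigma_sets UNIV ?E"
    by (simp_all add: borel_eq_box sets)
  let ?A = "\<lambda>n::nat. box (- (real n *\<^sub>R One)) (real n *\<^sub>R One) :: 'a set"
  show "range ?A \<subseteq> ?E" "(\<Union>i. ?A i) = UNIV"
    unfolding UN_box_eq_UNIV by auto
  show "emeasure (gauss \<mu> \<sigma>) (?A i) \<noteq> \<infinity>" for i
    by simp
  show "emeasure (gauss \<mu> \<sigma>) X = emeasure K X" if X: "X \<in> ?E" for X
  proof -
    obtain l u where X: "X = box l u"
      using X by auto
    have X': "X = {x. \<forall>b\<in>Basis. x \<bullet> b \<in> {l \<bullet> b<..<u \<bullet> b}}"
      unfolding X by (auto simp: box_def)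
    show ?thesis
      unfolding X' by (subst eq) (simp, rule emeasure_gauss_cylinder, simp)
  qed
qed

text \<open>With \<open>x\<close> and \<open>y\<close> independent, integrating over
  \<open>y\<close> alone plays the role of conditioning on the coordinates outside
  \<open>S\<close>.\<close>

definition mix :: "'a set \<Rightarrow> 'a \<Rightarrow> 'a \<Rightarrow> 'a::euclidean_space" where
  "mix S x y = (\<Sum>b\<in>Basis. (if b \<in> S then y \<bullet> b else x \<bullet> b) *\<^sub>R b)"

lemma inner_mix: "b \<in> Basis \<Longrightarrow> mix S x y \<bullet> b = (if b \<in> S then y \<bullet> b else x \<bullet> b)"
  by (simp add: mix_def)

lemma measurable_mix [measurable]:
  "(\<lambda>(x, y). mix S x y) \<in> borel \<Otimes>\<^sub>M borel \<rightarrow>\<^sub>M (borel :: 'a::euclidean_space measure)"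
  unfolding mix_def split_beta' by measurable

text \<open>The preimage of a cylinder is a product of two cylinders, each unconstrained where the
  other one is constrained; unconstrained coordinates contribute mass 1.\<close>

lemma distr_mix_gauss:
  assumes "\<sigma> > 0"
  shows "distr (gauss \<mu> \<sigma> \<Otimes>\<^sub>M gauss \<mu> \<sigma>) borel (\<lambda>(x, y). mix S x y) = gauss \<mu> \<sigma>"
proof (rule gauss_eqI)
  interpret prob_space "gauss \<mu> \<sigma>"
    by (rule prob_space_gauss) fact
  have UNIV1: "emeasure (gauss (\<mu> \<bullet> b) \<sigma>) UNIV = 1" for b
    using prob_space.emeasure_space_1[OF prob_space_gauss_real[OF assms, of "\<mu> \<bullet> b"]] by simp
  fix T :: "'a \<Rightarrow> real set" assume T: "\<And>b. T b \<in> sets borel"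
  let ?T1 = "\<lambda>b. if b \<in> S then UNIV else T b" and ?T2 = "\<lambda>b. if b \<in> S then T b else UNIV"
  let ?C = "\<lambda>T. {x. \<forall>b\<in>Basis. x \<bullet> b \<in> (T b :: real set)}"
  have C: "?C T \<in> sets borel" "?C ?T1 \<in> sets borel" "?C ?T2 \<in> sets borel"
    using T by (auto intro!: cylinder_sets)
  have "emeasure (distr (gauss \<mu> \<sigma> \<Otimes>\<^sub>M gauss \<mu> \<sigma>) borel (\<lambda>(x, y). mix S x y)) (?C T)
      = emeasure (gauss \<mu> \<sigma> \<Otimes>\<^sub>M gauss \<mu> \<sigma>) (?C ?T1 \<times> ?C ?T2)"
  proof -
    have "(\<lambda>(x, y). mix S x y) -` ?C T \<inter> space (gauss \<mu> \<sigma> \<Otimes>\<^sub>M gauss \<mu> \<sigma>) = ?C ?T1 \<times> ?C ?T2"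
      by (auto simp: inner_mix space_pair_measure split: if_splits)
    moreover have "(\<lambda>(x, y). mix S x y) \<in> gauss \<mu> \<sigma> \<Otimes>\<^sub>M gauss \<mu> \<sigma> \<rightarrow>\<^sub>M borel"
      by measurable
    ultimately show ?thesis
      using C by (simp add: emeasure_distr)
  qed
  also have "\<dots> = emeasure (gauss \<mu> \<sigma>) (?C ?T1) * emeasure (gauss \<mu> \<sigma>) (?C ?T2)"
    by (intro emeasure_pair_measure_Times) (use C in auto)
  also have "\<dots> = (\<Prod>b\<in>Basis. emeasure (gauss (\<mu> \<bullet> b) \<sigma>) (?T1 b) * emeasure (gauss (\<mu> \<bullet> b) \<sigma>) (?T2 b))"
    using T by (simp add: emeasure_gauss_cylinder prod.distrib)
  also have "\<dots> = (\<Prod>b\<in>Basis. emeasure (gauss (\<mu> \<bullet> b) \<sigma>) (T b))"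
    by (intro prod.cong) (auto simp: UNIV1)
  finally show "emeasure (distr (gauss \<mu> \<sigma> \<Otimes>\<^sub>M gauss \<mu> \<sigma>) borel (\<lambda>(x, y). mix S x y)) (?C T)
    = (\<Prod>b\<in>Basis. emeasure (gauss (\<mu> \<bullet> b) \<sigma>) (T b))" .
qed (use assms in auto)

text \<open>Fubini for a set of coordinates: the inner integral averages over those in
  \<open>S\<close> while the others stay frozen at \<open>x\<close>.\<close>

lemma nn_integral_mix_gauss:
  assumes "\<sigma> > 0" and [measurable]: "h \<in> borel_measurable borel"
  shows "(\<integral>\<^sup>+x. h x \<partial>gauss \<mu> \<sigma>) = (\<integral>\<^sup>+x. \<integral>\<^sup>+y. h (mix S x y) \<partial>gauss \<mu> \<sigma> \<partial>gauss \<mu> \<sigma>)"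
proof -
  interpret prob_space "gauss \<mu> \<sigma>"
    by (rule prob_space_gauss) fact
  have "(\<integral>\<^sup>+x. h x \<partial>gauss \<mu> \<sigma>)
      = (\<integral>\<^sup>+x. h x \<partial>distr (gauss \<mu> \<sigma> \<Otimes>\<^sub>M gauss \<mu> \<sigma>) borel (\<lambda>(x, y). mix S x y))"
    by (simp add: distr_mix_gauss assms)
  also have "\<dots> = (\<integral>\<^sup>+z. h (case z of (x, y) \<Rightarrow> mix S x y) \<partial>(gauss \<mu> \<sigma> \<Otimes>\<^sub>M gauss \<mu> \<sigma>))"
    by (rule nn_integral_distr) measurable
  also have "\<dots> = (\<integral>\<^sup>+x. \<integral>\<^sup>+y. h (case (x, y) of (x, y) \<Rightarrow> mix S x y) \<partial>gauss \<mu> \<sigma> \<partial>gauss \<mu> \<sigma>)"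
    by (rule nn_integral_fst[symmetric]) measurable
  finally show ?thesis by simp
qed

text \<open>Two translation invariant measures agree up to a factor; the factor is read off
  a function of the norm, here the indicator of the unit ball.\<close>

lemma nn_integral_lborel_isometry:
  fixes f :: "'a::euclidean_space \<Rightarrow> 'a"
  assumes f: "linear f" "\<And>x. norm (f x) = norm x"
    and h [measurable]: "h \<in> borel_measurable borel"
  shows "(\<integral>\<^sup>+x. h (f x) \<partial>lborel) = (\<integral>\<^sup>+x. h x \<partial>lborel)"
proof -
  have [measurable]: "f \<in> borel_measurable borel"
    using f(1) by (intro borel_measurable_continuous_onI linear_continuous_on)
      (simp add: linear_conv_bounded_linear)
  have "inj f"
    using f by (metis linear_injective_0 norm_eq_zero)
  then have "surj f"
    using f(1) linear_injective_imp_surjective by blast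
  have translate: "(\<integral>\<^sup>+x. g (x + a) \<partial>lborel) = (\<integral>\<^sup>+x. g x \<partial>lborel)"
    if [measurable]: "g \<in> borel_measurable borel" for g and a :: 'a
  proof -
    have "(\<integral>\<^sup>+x. g x \<partial>lborel) = (\<integral>\<^sup>+x. g x \<partial>distr lborel borel (\<lambda>x. a + 1 *\<^sub>R x))"
      by (subst lborel_affine[of 1 a]) (simp_all add: density_1)
    then show ?thesis
      by (simp add: nn_integral_distr add.commute)
  qed
  have translate_f: "(\<integral>\<^sup>+x. g (f x + a) \<partial>lborel) = (\<integral>\<^sup>+x. g (f x) \<partial>lborel)"
    if [measurable]: "g \<in> borel_measurable borel" for g and a :: 'a
  proof -
    obtain b where "a = f b"
      using \<open>surj f\<close> by (metis surjD)
    then show ?thesis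
      using translate[of "\<lambda>x. g (f x)" b] f(1) by (simp add: linear_add)
  qed
  define U :: "'a \<Rightarrow> ennreal" where "U = indicator (ball 0 1)"
  have [measurable]: "U \<in> borel_measurable borel"
    unfolding U_def by (rule borel_measurable_indicator) simp
  \<comment> \<open>Both integrals are multiplied by \<open>?c\<close>. Averaging over translates
    and exchanging integrals moves \<open>f\<close> into the argument of \<open>U\<close>, where it
    is invisible because \<open>U\<close> depends only on the norm.\<close>
  let ?c = "\<integral>\<^sup>+y. U y \<partial>lborel"
  have U_norm: "U x = U y" if "norm x = norm y" for x y
    using that by (simp add: U_def indicator_def)
  have "(\<integral>\<^sup>+x. h (f x) \<partial>lborel) * ?c = (\<integral>\<^sup>+y. \<integral>\<^sup>+x. h (f x) * U y \<partial>lborel \<partial>lborel)"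
    by (simp add: nn_integral_multc nn_integral_cmult)
  also have "\<dots> = (\<integral>\<^sup>+y. \<integral>\<^sup>+x. h (f x + y) * U y \<partial>lborel \<partial>lborel)"
    by (rule nn_integral_cong) (simp add: nn_integral_multc translate_f)
  also have "\<dots> = (\<integral>\<^sup>+x. \<integral>\<^sup>+y. h (f x + y) * U y \<partial>lborel \<partial>lborel)"
    by (rule lborel_pair.Fubini') measurable
  also have "\<dots> = (\<integral>\<^sup>+x. \<integral>\<^sup>+y. h y * U (y - f x) \<partial>lborel \<partial>lborel)"
  proof (rule nn_integral_cong)
    fix x :: 'a
    show "(\<integral>\<^sup>+y. h (f x + y) * U y \<partial>lborel) = (\<integral>\<^sup>+y. h y * U (y - f x) \<partial>lborel)"
      using translate[of "\<lambda>y. h y * U (y - f x)" "f x"] by (simp add: add.commute)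
  qed
  also have "\<dots> = (\<integral>\<^sup>+y. \<integral>\<^sup>+x. h y * U (y - f x) \<partial>lborel \<partial>lborel)"
    by (rule lborel_pair.Fubini') measurable
  also have "\<dots> = (\<integral>\<^sup>+y. h y * ?c \<partial>lborel)"
  proof (rule nn_integral_cong)
    fix y :: 'a
    have "(\<integral>\<^sup>+x. U (y - f x) \<partial>lborel) = (\<integral>\<^sup>+x. U (f x + (- y)) \<partial>lborel)"
      by (intro nn_integral_cong U_norm) (simp add: norm_minus_commute)
    also have "\<dots> = (\<integral>\<^sup>+x. U (f x) \<partial>lborel)"
      by (rule translate_f) measurable
    also have "\<dots> = ?c"
      by (intro nn_integral_cong U_norm) (simp add: f(2))
    finally show "(\<integral>\<^sup>+x. h y * U (y - f x) \<partial>lborel) = h y * ?c"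
      by (simp add: nn_integral_cmult)
  qed
  also have "\<dots> = (\<integral>\<^sup>+y. h y \<partial>lborel) * ?c"
    by (rule nn_integral_multc) measurable
  finally have eq: "(\<integral>\<^sup>+x. h (f x) \<partial>lborel) * ?c = (\<integral>\<^sup>+y. h y \<partial>lborel) * ?c" .
  have "?c \<noteq> \<top>" "?c \<noteq> 0"
    by (simp_all add: U_def emeasure_ball less_imp_neq[OF unit_ball_vol_pos, symmetric])
  with eq show ?thesis
    by (simp add: ennreal_mult_cancel_left mult.commute[of _ ?c])
qed

section \<open>Rotation invariance and small balls\<close>

text \<open>The Householder reflection in the hyperplane orthogonal to \<open>v\<close>. For
  \<open>v = 0\<close> the division convention makes it the identity, so two vectors to be exchanged
  may coincide.\<close>

definition reflection :: "'a::real_inner \<Rightarrow> 'a \<Rightarrow> 'a" where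
  "reflection v x = x - (2 * (v \<bullet> x) / (v \<bullet> v)) *\<^sub>R v"

lemma linear_reflection: "linear (reflection v)"
  by (rule linearI) (simp_all add: reflection_def inner_add_right add_divide_distrib
      scaleR_add_left scaleR_diff_right algebra_simps)

lemma reflection_reflection: "reflection v (reflection v x) = x"
  by (simp add: reflection_def inner_diff_right algebra_simps flip: scaleR_add_left)

lemma inner_reflection: "reflection v x \<bullet> reflection v y = x \<bullet> y"
proof -
  define c where "c = 2 * (v \<bullet> x) / (v \<bullet> v)"
  define d where "d = 2 * (v \<bullet> y) / (v \<bullet> v)"
  have c: "c * (v \<bullet> v) = 2 * (v \<bullet> x)" and d: "d * (v \<bullet> v) = 2 * (v \<bullet> y)"
    by (auto simp: c_def d_def)
  have r: "reflection v x = x - c *\<^sub>R v" "reflection v y = y - d *\<^sub>R v"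
    by (simp_all add: reflection_def c_def d_def)
  have "reflection v x \<bullet> reflection v y
      = x \<bullet> y - d * (v \<bullet> x) - c * (v \<bullet> y) + c * (d * (v \<bullet> v))"
    unfolding r by (simp add: inner_diff_left inner_diff_right inner_commute algebra_simps)
  also have "\<dots> = x \<bullet> y"
    using c d by algebra
  finally show ?thesis .
qed

lemma norm_reflection: "norm (reflection v x) = norm x"
  by (simp add: norm_eq inner_reflection)

text \<open>Equal norms make the coefficient of \<open>u - w\<close> in the reflection of
  \<open>u\<close> equal to 1.\<close>

lemma reflection_swap:
  assumes "norm u = norm w"
  shows "reflection (u - w) u = w"
proof (cases "u = w")
  case False
  have "(u - w) \<bullet> (u - w) = 2 * ((u - w) \<bullet> u)"
    using assms by (simp add: inner_diff_left inner_diff_right inner_commute norm_eq)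
  moreover have "(u - w) \<bullet> (u - w) \<noteq> 0"
    using False by simp
  ultimately show ?thesis
    by (simp add: reflection_def)
qed (simp add: reflection_def)

section \<open>Isometries acting on Gaussian measures\<close>

lemma measurable_linear:
  fixes f :: "'a::euclidean_space \<Rightarrow> 'b::euclidean_space"
  shows "linear f \<Longrightarrow> f \<in> borel_measurable borel"
  by (intro borel_measurable_continuous_onI linear_continuous_on)
    (simp add: linear_conv_bounded_linear)

text \<open>The exponents of the coordinates add up to the squared distance from the mean; this
  radial form is the source of rotation invariance.\<close>

lemma gauss_density_norm:
  fixes x \<mu> :: "'a::euclidean_space"
  shows "(\<Prod>b\<in>Basis. ennreal (normal_density (\<mu> \<bullet> b) \<sigma> (x \<bullet> b)))
    = ennreal ((1 / sqrt (2 * pi * \<sigma>\<^sup>2)) ^ DIM('a) * exp (- (norm (x - \<mu>))\<^sup>2 / (2 * \<sigma>\<^sup>2)))"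
proof -
  have "(norm (x - \<mu>))\<^sup>2 = (\<Sum>b\<in>Basis. (x \<bullet> b - \<mu> \<bullet> b)\<^sup>2)"
    unfolding norm_eq_sqrt_inner by (subst euclidean_inner) (simp add: power2_eq_square inner_diff_left sum_nonneg)
  then have "- (norm (x - \<mu>))\<^sup>2 / (2 * \<sigma>\<^sup>2) = (\<Sum>b\<in>Basis. - (x \<bullet> b - \<mu> \<bullet> b)\<^sup>2 / (2 * \<sigma>\<^sup>2))"
    by (simp add: sum_negf sum_divide_distrib)
  then show ?thesis
    by (simp add: prod_ennreal normal_density_def exp_sum prod_dividef power_divide power_one_over)
qed

lemma nn_integral_gauss_isometry:
  fixes f :: "'a::euclidean_space \<Rightarrow> 'a"
  assumes f: "linear f" "\<And>x. norm (f x) = norm x"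
    and [measurable]: "h \<in> borel_measurable borel"
  shows "(\<integral>\<^sup>+x. h (f x) \<partial>gauss \<mu> \<sigma>) = (\<integral>\<^sup>+x. h x \<partial>gauss (f \<mu>) \<sigma>)"
proof -
  have [measurable]: "f \<in> borel_measurable borel"
    using f(1) by (rule measurable_linear)
  have *: "norm (f x - f \<mu>) = norm (x - \<mu>)" for x
    using f by (metis linear_diff)
  let ?D = "\<lambda>z \<mu>. ennreal ((1 / sqrt (2 * pi * \<sigma>\<^sup>2)) ^ DIM('a) * exp (- (norm (z - \<mu>))\<^sup>2 / (2 * \<sigma>\<^sup>2)))"
  have "(\<integral>\<^sup>+x. h (f x) \<partial>gauss \<mu> \<sigma>) = (\<integral>\<^sup>+x. ?D (f x) (f \<mu>) * h (f x) \<partial>lborel)"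
    by (subst nn_integral_gauss) (simp_all add: gauss_density_norm *)
  also have "\<dots> = (\<integral>\<^sup>+x. ?D x (f \<mu>) * h x \<partial>lborel)"
    using f by (rule nn_integral_lborel_isometry) simp
  also have "\<dots> = (\<integral>\<^sup>+x. h x \<partial>gauss (f \<mu>) \<sigma>)"
    by (subst nn_integral_gauss) (simp_all add: gauss_density_norm)
  finally show ?thesis .
qed

lemma nn_integral_gauss_inner_Basis:
  assumes "b \<in> Basis" "\<sigma> > 0" and [measurable]: "h \<in> borel_measurable borel"
  shows "(\<integral>\<^sup>+x. h (b \<bullet> x) \<partial>gauss \<mu> \<sigma>) = (\<integral>\<^sup>+y. h y \<partial>gauss (b \<bullet> \<mu>) \<sigma>)"
proof -
  have "(\<integral>\<^sup>+x. h (b \<bullet> x) \<partial>gauss \<mu> \<sigma>)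
      = (\<integral>\<^sup>+x. (\<Prod>c\<in>Basis. (if c = b then h (x \<bullet> c) else 1)) \<partial>gauss \<mu> \<sigma>)"
    using assms(1) by (simp add: prod.delta' inner_commute cong: if_cong)
  also have "\<dots> = (\<Prod>c\<in>Basis. \<integral>\<^sup>+y. (if c = b then h y else 1) \<partial>gauss (\<mu> \<bullet> c) \<sigma>)"
    by (rule nn_integral_gauss_prod) simp
  also have "\<dots> = (\<Prod>c\<in>Basis. if c = b then \<integral>\<^sup>+y. h y \<partial>gauss (\<mu> \<bullet> c) \<sigma> else 1)"
    using prob_space.emeasure_space_1[OF prob_space_gauss_real[OF \<open>\<sigma> > 0\<close>]]
    by (intro prod.cong) auto
  also have "\<dots> = (\<integral>\<^sup>+y. h y \<partial>gauss (b \<bullet> \<mu>) \<sigma>)"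
    using assms(1) by (simp add: prod.delta' inner_commute)
  finally show ?thesis .
qed

text \<open>A reflection carries \<open>w\<close> to a basis vector, which reduces the claim to the
  marginal of a single coordinate.\<close>

lemma nn_integral_gauss_inner:
  fixes w :: "'a::euclidean_space"
  assumes w: "norm w = 1" and "\<sigma> > 0" and [measurable]: "h \<in> borel_measurable borel"
  shows "(\<integral>\<^sup>+x. h (w \<bullet> x) \<partial>gauss \<mu> \<sigma>) = (\<integral>\<^sup>+y. h y \<partial>gauss (w \<bullet> \<mu>) \<sigma>)"
proof -
  obtain b :: 'a where b: "b \<in> Basis"
    using nonempty_Basis by blast
  let ?f = "reflection (w - b)"
  have f: "w \<bullet> x = b \<bullet> ?f x" for x
    using inner_reflection[of "w - b" w x] reflection_swap[of w b] w b by simp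
  have "(\<integral>\<^sup>+x. h (w \<bullet> x) \<partial>gauss \<mu> \<sigma>) = (\<integral>\<^sup>+x. h (b \<bullet> x) \<partial>gauss (?f \<mu>) \<sigma>)"
    unfolding f by (rule nn_integral_gauss_isometry)
      (simp_all add: linear_reflection norm_reflection)
  also have "\<dots> = (\<integral>\<^sup>+y. h y \<partial>gauss (w \<bullet> \<mu>) \<sigma>)"
    unfolding f using b assms by (intro nn_integral_gauss_inner_Basis)
  finally show ?thesis .
qed

lemma normal_density_le: "normal_density \<mu> \<sigma> x \<le> 1 / sqrt (2 * pi * \<sigma>\<^sup>2)"
  by (simp add: normal_density_def divide_right_mono)

text \<open>Peak of the density times the length \<open>2 * r\<close> of the interval; hence the
  bound is uniform in the mean.\<close>

lemma emeasure_gauss_small: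
  fixes \<mu> :: real
  assumes "\<sigma> > 0" "r \<ge> 0"
  shows "emeasure (gauss \<mu> \<sigma>) {y. \<bar>y\<bar> < r} \<le> ennreal (sqrt (2 / pi) / \<sigma> * r)"
proof -
  have "emeasure (gauss \<mu> \<sigma>) {y. \<bar>y\<bar> < r} = (\<integral>\<^sup>+y. ennreal (normal_density \<mu> \<sigma> y) * indicator {-r<..<r} y \<partial>lborel)"
    unfolding gauss_real by (subst emeasure_density) (auto intro!: nn_integral_cong simp: indicator_def)
  also have "\<dots> \<le> (\<integral>\<^sup>+y. ennreal (1 / sqrt (2 * pi * \<sigma>\<^sup>2)) * indicator {-r<..<r} y \<partial>lborel)"
    by (intro nn_integral_mono mult_right_mono ennreal_leI normal_density_le) auto
  also have "\<dots> = ennreal (1 / sqrt (2 * pi * \<sigma>\<^sup>2) * (2 * r))"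
    using assms by (subst nn_integral_cmult_indicator, simp, subst emeasure_lborel_Ioo)
      (simp_all flip: ennreal_mult)
  also have "1 / sqrt (2 * pi * \<sigma>\<^sup>2) * (2 * r) = sqrt (2 / pi) / \<sigma> * r"
    using assms by (simp add: real_sqrt_mult real_sqrt_divide field_simps)
  finally show ?thesis .
qed

lemma inner_mix_right:
  assumes "\<And>b. b \<in> Basis \<Longrightarrow> b \<notin> S \<Longrightarrow> w \<bullet> b = 0"
  shows "w \<bullet> mix S x y = w \<bullet> y"
  unfolding euclidean_inner[of w "mix S x y"] euclidean_inner[of w y]
  using assms by (intro sum.cong) (auto simp: inner_mix)

text \<open>The functional \<open>w\<close> reads only the coordinates in \<open>S\<close>, and the
  threshold \<open>h\<close> ignores them. After resampling \<open>S\<close> the threshold is a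
  constant for the inner integral, where the small ball bound applies.\<close>

lemma emeasure_gauss_inner_less:
  fixes w :: "'a::euclidean_space" and h :: "'a \<Rightarrow> real"
  assumes "\<sigma> > 0" and w: "norm w = 1" "\<And>b. b \<in> Basis \<Longrightarrow> b \<notin> S \<Longrightarrow> w \<bullet> b = 0"
    and h: "\<And>x y. h (mix S x y) = h x" "\<And>x. 0 \<le> h x" and [measurable]: "h \<in> borel_measurable borel"
  shows "emeasure (gauss \<mu> \<sigma>) {x. \<bar>w \<bullet> x\<bar> < h x}
    \<le> (\<integral>\<^sup>+x. ennreal (sqrt (2 / pi) / \<sigma> * h x) \<partial>gauss \<mu> \<sigma>)"
proof -
  have "emeasure (gauss \<mu> \<sigma>) {x. \<bar>w \<bullet> x\<bar> < h x}
      = (\<integral>\<^sup>+x. indicator {x. \<bar>w \<bullet> x\<bar> < h x} x \<partial>gauss \<mu> \<sigma>)"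
    by (rule nn_integral_indicator[symmetric]) measurable
  also have "\<dots> = (\<integral>\<^sup>+x. \<integral>\<^sup>+y. indicator {x. \<bar>w \<bullet> x\<bar> < h x} (mix S x y) \<partial>gauss \<mu> \<sigma> \<partial>gauss \<mu> \<sigma>)"
    using \<open>\<sigma> > 0\<close> by (rule nn_integral_mix_gauss) measurable
  also have "\<dots> = (\<integral>\<^sup>+x. \<integral>\<^sup>+y. indicator {z. \<bar>z\<bar> < h x} (w \<bullet> y) \<partial>gauss \<mu> \<sigma> \<partial>gauss \<mu> \<sigma>)"
    by (simp add: indicator_def h inner_mix_right[OF w(2)])
  also have "\<dots> = (\<integral>\<^sup>+x. emeasure (gauss (w \<bullet> \<mu>) \<sigma>) {z. \<bar>z\<bar> < h x} \<partial>gauss \<mu> \<sigma>)"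
    using w \<open>\<sigma> > 0\<close> by (simp add: nn_integral_gauss_inner)
  also have "\<dots> \<le> (\<integral>\<^sup>+x. ennreal (sqrt (2 / pi) / \<sigma> * h x) \<partial>gauss \<mu> \<sigma>)"
    by (intro nn_integral_mono emeasure_gauss_small assms)
  finally show ?thesis .
qed

lemma nn_integral_gauss_power2:
  fixes \<mu> :: real
  assumes "\<sigma> > 0"
  shows "(\<integral>\<^sup>+y. ennreal (y\<^sup>2) \<partial>gauss \<mu> \<sigma>) = ennreal (\<mu>\<^sup>2 + \<sigma>\<^sup>2)"
proof -
  let ?\<phi> = "normal_density \<mu> \<sigma>"
  have "has_bochner_integral lborel (\<lambda>y. ?\<phi> y * (y - \<mu>)\<^sup>2) (\<sigma>\<^sup>2)"
    using normal_moment_even[OF assms, of \<mu> 1] by (simp add: fact_numeral)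
  moreover have "has_bochner_integral lborel (\<lambda>y. ?\<phi> y * y) \<mu>"
    using assms by (rule normal_moment_nz_1)
  moreover have "has_bochner_integral lborel ?\<phi> 1"
    using normal_moment_even[OF assms, of \<mu> 0] by simp
  ultimately have "has_bochner_integral lborel
      (\<lambda>y. ?\<phi> y * (y - \<mu>)\<^sup>2 + ?\<phi> y * y * (2 * \<mu>) - ?\<phi> y * \<mu>\<^sup>2)
      (\<sigma>\<^sup>2 + \<mu> * (2 * \<mu>) - 1 * \<mu>\<^sup>2)"
    by (intro has_bochner_integral_add has_bochner_integral_diff has_bochner_integral_mult_left)
  moreover have "?\<phi> y * (y - \<mu>)\<^sup>2 + ?\<phi> y * y * (2 * \<mu>) - ?\<phi> y * \<mu>\<^sup>2 = ?\<phi> y * y\<^sup>2" for y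
    by algebra
  moreover have "\<sigma>\<^sup>2 + \<mu> * (2 * \<mu>) - 1 * \<mu>\<^sup>2 = \<mu>\<^sup>2 + \<sigma>\<^sup>2"
    by algebra
  ultimately have "has_bochner_integral lborel (\<lambda>y. ?\<phi> y * y\<^sup>2) (\<mu>\<^sup>2 + \<sigma>\<^sup>2)"
    by (simp only:)
  then have "(\<integral>\<^sup>+y. ennreal (?\<phi> y * y\<^sup>2) \<partial>lborel) = ennreal (\<mu>\<^sup>2 + \<sigma>\<^sup>2)"
    by (intro nn_integral_eq_integral[THEN trans])
      (auto simp: has_bochner_integral_iff)
  then show ?thesis
    by (simp add: nn_integral_gauss_real ennreal_mult)
qed

lemma nn_integral_gauss_inner_power2:
  assumes "norm w = 1" "\<sigma> > 0"
  shows "(\<integral>\<^sup>+x. ennreal ((w \<bullet> x)\<^sup>2) \<partial>gauss \<mu> \<sigma>) = ennreal ((w \<bullet> \<mu>)\<^sup>2 + \<sigma>\<^sup>2)"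
  using nn_integral_gauss_inner[OF assms, of "\<lambda>y. ennreal (y\<^sup>2)"] nn_integral_gauss_power2[OF assms(2)]
  by simp

section \<open>The inverse of an l1 norm\<close>

text \<open>The left side is the Laplace transform of the uniform law on [0, 1]. The rational bound
  is used because its powers integrate in closed form. After clearing denominators the claim says
  \<open>?h z\<close> is nonnegative, and \<open>?h\<close> vanishes at 0 and has a nonnegative
  derivative.\<close>

lemma one_minus_exp_le:
  fixes z :: real
  assumes "z > 0"
  shows "(1 - exp (- z)) / z \<le> 1 / (1 + z / 2)"
proof -
  let ?h = "\<lambda>z::real. exp (- z) * (1 + z / 2) - 1 + z / 2"
  have "?h 0 \<le> ?h z"
  proof (rule DERIV_nonneg_imp_nondecreasing[of 0 z ?h])
    fix y :: real
    assume "0 \<le> y"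
    have "DERIV ?h y :> (1 - exp (- y) * (1 + y)) / 2"
      by (auto intro!: derivative_eq_intros simp: field_simps)
    moreover have "exp (- y) * (1 + y) \<le> exp (- y) * exp y"
      by (intro mult_left_mono exp_ge_add_one_self) auto
    ultimately show "\<exists>d. DERIV ?h y :> d \<and> 0 \<le> d"
      by (intro exI conjI) (auto simp flip: exp_add)
  qed (use assms in auto)
  then show ?thesis
    using assms by (simp add: field_simps)
qed

text \<open>Among the densities bounded by \<open>1 / (2 \<delta>)\<close>, the uniform one on \<open>[-\<delta>, \<delta>]\<close> has the
  largest Laplace transform of the absolute value.\<close>

lemma laplace_gauss_le:
  fixes \<mu> :: real
  assumes "\<sigma> > 0" "l > 0"
  shows "(\<integral>\<^sup>+y. ennreal (exp (- l * \<bar>y\<bar>)) \<partial>gauss \<mu> \<sigma>) \<le> ennreal (1 / (1 + 9 / 16 * \<sigma> * l))"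
proof -
  \<comment> \<open>The comparison allows any half width up to sqrt (pi / 2) times
    \<open>\<sigma>\<close>, about 1.25 \<open>\<sigma>\<close>. The factor 9/8 is a rational below
    that which produces the constants 4/3 and 2/3 of the final bound.\<close>
  define \<delta> where "\<delta> = 9 / 8 * \<sigma>"
  have "\<delta> > 0"
    using assms by (simp add: \<delta>_def)
  have density: "normal_density \<mu> \<sigma> y \<le> 1 / (2 * \<delta>)" for y
  proof -
    have "(2 * \<delta>)\<^sup>2 \<le> 2 * pi * \<sigma>\<^sup>2"
      unfolding \<delta>_def using pi_gt3 assms by (simp add: power2_eq_square)
    then have "2 * \<delta> \<le> sqrt (2 * pi * \<sigma>\<^sup>2)"
      by (rule real_le_rsqrt)
    then have "1 / sqrt (2 * pi * \<sigma>\<^sup>2) \<le> 1 / (2 * \<delta>)"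
      using \<open>\<delta> > 0\<close> by (intro divide_left_mono) (auto intro: mult_pos_pos order_less_le_trans)
    with normal_density_le[of \<mu> \<sigma> y] show ?thesis by linarith
  qed
  interpret prob_space "gauss \<mu> \<sigma>"
    using assms by (intro prob_space_gauss)
  let ?e = "exp (- l * \<delta>)"
  let ?g1 = "\<lambda>y. exp (- l * y) - ?e" and ?g2 = "\<lambda>y. exp (l * y) - ?e"
  \<comment> \<open>The integral over \<open>{0..\<delta>}\<close> of the excess of
    \<open>exp (- l * y)\<close> over its value \<open>?e\<close> at the right end.\<close>
  define c where "c = (1 - ?e) / l - ?e * \<delta>"
  have g1: "(\<integral>\<^sup>+y. ennreal (?g1 y) * indicator {0..\<delta>} y \<partial>lborel) = ennreal c"
  proof -
    have "(\<integral>\<^sup>+y. ennreal (?g1 y) * indicator {0..\<delta>} y \<partial>lborel)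
        = (- exp (- l * \<delta>) / l - ?e * \<delta>) - (- exp (- l * 0) / l - ?e * 0)"
      by (rule nn_integral_FTC_Icc)
        (use \<open>\<delta> > 0\<close> assms in \<open>auto intro!: derivative_eq_intros\<close>)
    also have "\<dots> = ennreal c"
      by (simp add: c_def diff_divide_distrib algebra_simps)
    finally show ?thesis .
  qed
  have g2: "(\<integral>\<^sup>+y. ennreal (?g2 y) * indicator {-\<delta>..0} y \<partial>lborel) = ennreal c"
  proof -
    have "l * (- \<delta>) \<le> l * y" if "- \<delta> \<le> y" for y
      using that assms by (intro mult_left_mono) auto
    then have "(\<integral>\<^sup>+y. ennreal (?g2 y) * indicator {-\<delta>..0} y \<partial>lborel)
        = (exp (l * 0) / l - ?e * 0) - (exp (l * (- \<delta>)) / l - ?e * (- \<delta>))"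
      by (intro nn_integral_FTC_Icc)
        (use \<open>\<delta> > 0\<close> assms in \<open>auto intro!: derivative_eq_intros\<close>)
    also have "\<dots> = ennreal c"
      by (simp add: c_def diff_divide_distrib algebra_simps)
    finally show ?thesis .
  qed
  have "c \<ge> 0"
  proof -
    have "1 + l * \<delta> \<le> exp (l * \<delta>)"
      by (rule exp_ge_add_one_self)
    then have "(1 + l * \<delta>) * ?e \<le> exp (l * \<delta>) * ?e"
      by (intro mult_right_mono) auto
    then have "(1 + l * \<delta>) * ?e \<le> 1"
      by (simp flip: exp_add)
    then show ?thesis
      using assms by (simp add: c_def field_simps)
  qed
  \<comment> \<open>Bathtub argument: the constant \<open>?e\<close> will be integrated against
    total mass 1, and the excess, which lives on the interval, against the bound on the
    density.\<close>
  have le: "ennreal (exp (- l * \<bar>y\<bar>))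
      \<le> ennreal ?e + (ennreal (?g1 y) * indicator {0..\<delta>} y + ennreal (?g2 y) * indicator {-\<delta>..0} y)" for y
  proof -
    consider "0 \<le> y" "y \<le> \<delta>" | "y < 0" "- \<delta> \<le> y" | "\<bar>y\<bar> > \<delta>"
      by linarith
    then show ?thesis
    proof cases
      case 1
      then have "ennreal (exp (- l * \<bar>y\<bar>)) = ennreal ?e + ennreal (?g1 y) * indicator {0..\<delta>} y"
        using assms by (simp flip: ennreal_plus)
      then show ?thesis
        by (simp add: add_increasing2 add_left_mono)
    next
      case 2
      have "l * (- \<delta>) \<le> l * y"
        using 2 assms by (intro mult_left_mono) auto
      with 2 have "ennreal (exp (- l * \<bar>y\<bar>)) = ennreal ?e + ennreal (?g2 y) * indicator {-\<delta>..0} y"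
        using assms by (simp flip: ennreal_plus)
      then show ?thesis
        by (simp add: add_increasing add_left_mono)
    next
      case 3
      then have "exp (- l * \<bar>y\<bar>) \<le> ?e"
        using assms by simp
      then show ?thesis
        by (intro add_increasing2 ennreal_leI) auto
    qed
  qed
  have "(\<integral>\<^sup>+y. ennreal (exp (- l * \<bar>y\<bar>)) \<partial>gauss \<mu> \<sigma>)
      \<le> (\<integral>\<^sup>+y. ennreal ?e + (ennreal (?g1 y) * indicator {0..\<delta>} y + ennreal (?g2 y) * indicator {-\<delta>..0} y)
          \<partial>gauss \<mu> \<sigma>)"
    by (intro nn_integral_mono le)
  also have "\<dots> = ennreal ?e + (\<integral>\<^sup>+y. ennreal (?g1 y) * indicator {0..\<delta>} y + ennreal (?g2 y) * indicator {-\<delta>..0} y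
          \<partial>gauss \<mu> \<sigma>)"
    using emeasure_space_1 by (subst nn_integral_add) auto
  also have "\<dots> \<le> ennreal ?e + (\<integral>\<^sup>+y. ennreal (1 / (2 * \<delta>)) * (ennreal (?g1 y) * indicator {0..\<delta>} y + ennreal (?g2 y) * indicator {-\<delta>..0} y)
          \<partial>lborel)"
    by (subst nn_integral_gauss_real, simp)
      (intro add_left_mono nn_integral_mono mult_right_mono ennreal_leI density, simp)
  also have "\<dots> = ennreal ?e + ennreal (1 / (2 * \<delta>)) * (ennreal c + ennreal c)"
    by (subst nn_integral_cmult, measurable, subst nn_integral_add, measurable, simp only: g1 g2)
  also have "\<dots> = ennreal (?e + 1 / (2 * \<delta>) * (c + c))"
    using \<open>c \<ge> 0\<close> \<open>\<delta> > 0\<close> by (simp flip: ennreal_mult ennreal_plus)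
  \<comment> \<open>The two halves recombine to the exact transform of the uniform law, because the
    \<open>?e\<close> terms cancel.\<close>
  also have "?e + 1 / (2 * \<delta>) * (c + c) = (1 - exp (- (l * \<delta>))) / (l * \<delta>)"
    using assms \<open>\<delta> > 0\<close> by (simp add: c_def field_simps)
  also have "ennreal \<dots> \<le> ennreal (1 / (1 + l * \<delta> / 2))"
    by (intro ennreal_leI one_minus_exp_le mult_pos_pos assms \<open>\<delta> > 0\<close>)
  also have "1 + l * \<delta> / 2 = 1 + 9 / 16 * \<sigma> * l"
    by (simp add: \<delta>_def)
  finally show ?thesis .
qed

text \<open>Extended nonnegative values make the identity valid at \<open>d = 0\<close> too, where
  both sides are infinite.\<close>

lemma inverse_eq_nn_integral_exp:
  fixes d :: real
  assumes "d \<ge> 0"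
  shows "inverse (ennreal d) = (\<integral>\<^sup>+l. ennreal (exp (- l * d)) * indicator {0..} l \<partial>lborel)"
proof (cases "d = 0")
  case False
  with assms have "d > 0" by simp
  then have "(\<integral>\<^sup>+l. ennreal (exp (- l * d)) * indicator {0..} l \<partial>lborel) = 0 - (- exp (- 0 * d) / d)"
  proof (intro nn_integral_FTC_atLeast)
    show "((\<lambda>l. - exp (- l * d) / d) \<longlongrightarrow> 0) at_top"
      using \<open>d > 0\<close> by real_asymp
  qed (auto intro!: derivative_eq_intros)
  then show ?thesis
    using \<open>d > 0\<close> by (simp add: inverse_ennreal inverse_eq_divide)
next
  case True
  have "of_nat n \<le> emeasure lborel {0::real..}" for n :: nat
    using emeasure_mono[of "{0..real n}" "{0::real..}" lborel] by (simp add: ennreal_of_nat_eq_real_of_nat)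
  then have "emeasure lborel {0::real..} = \<top>"
    by (metis ennreal_Ex_less_of_nat linorder_not_less top.not_eq_extremum)
  then show ?thesis
    using True by simp
qed

text \<open>The antiderivative has exponent \<open>n - 1\<close>, whence the factor in the
  denominator. For exponent 1 the integral would diverge, so at least two columns are
  required.\<close>

lemma nn_integral_inverse_power:
  fixes \<kappa> :: real
  assumes "\<kappa> > 0" "n \<ge> 2"
  shows "(\<integral>\<^sup>+l. ennreal ((1 / (1 + \<kappa> * l)) ^ n) * indicator {0..} l \<partial>lborel) = ennreal (1 / (\<kappa> * (real n - 1)))"
proof -
  obtain m where n: "n = Suc m" "m \<ge> 1"
    using assms by (cases n) auto
  have pos: "1 + \<kappa> * l > 0" if "l \<ge> 0" for l
    using that assms by (simp add: add_pos_nonneg)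
  have "(\<integral>\<^sup>+l. ennreal ((1 / (1 + \<kappa> * l)) ^ n) * indicator {0..} l \<partial>lborel)
      = 0 - (- ((1 / (1 + \<kappa> * 0)) ^ m / (\<kappa> * m)))"
  proof (intro nn_integral_FTC_atLeast)
    show "((\<lambda>l. - ((1 / (1 + \<kappa> * l)) ^ m / (\<kappa> * m))) \<longlongrightarrow> 0) at_top"
    proof -
      have "((\<lambda>l. 1 / (1 + \<kappa> * l)) \<longlongrightarrow> 0) at_top"
        using assms by real_asymp
      then have "((\<lambda>l. - ((1 / (1 + \<kappa> * l)) ^ m / (\<kappa> * m))) \<longlongrightarrow> - (0 ^ m / (\<kappa> * m))) at_top"
        using assms n by (intro tendsto_intros) auto
      then show ?thesis
        using n by (simp add: power_0_left)
    qed
    fix l :: real assume "0 \<le> l"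
    then have "1 + \<kappa> * l \<noteq> 0"
      using pos[of l] by simp
    then have "((\<lambda>l. 1 / (1 + \<kappa> * l)) has_real_derivative - (\<kappa> / (1 + \<kappa> * l)\<^sup>2)) (at l)"
      by (auto intro!: derivative_eq_intros simp: power2_eq_square)
    from DERIV_cdivide[OF DERIV_power[OF this, of m], of "\<kappa> * m", THEN DERIV_minus]
    show "((\<lambda>l. - ((1 / (1 + \<kappa> * l)) ^ m / (\<kappa> * m))) has_real_derivative (1 / (1 + \<kappa> * l)) ^ n) (at l)"
      by (rule DERIV_cong)
        (use assms n \<open>1 + \<kappa> * l \<noteq> 0\<close> in \<open>cases m; simp add: power2_eq_square\<close>)
    show "0 \<le> (1 / (1 + \<kappa> * l)) ^ n"
      using pos[OF \<open>0 \<le> l\<close>] by simp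
  qed measurable
  then show ?thesis
    by (simp add: n)
qed

lemma prod_mono_ennreal:
  fixes f g :: "'a \<Rightarrow> ennreal"
  assumes "\<And>b. b \<in> B \<Longrightarrow> f b \<le> g b"
  shows "prod f B \<le> prod g B"
  using assms by (induction B rule: infinite_finite_induct) (auto intro!: mult_mono)

text \<open>After exchanging the integrals, the exponential of the sum factors over the coordinates.
  Those outside \<open>S\<close> contribute 1 and each one in \<open>S\<close> at most the same
  rational factor, which leaves a power to integrate.\<close>

lemma nn_integral_gauss_inverse_sum_abs:
  fixes S :: "'a::euclidean_space set"
  assumes "\<sigma> > 0" "S \<subseteq> Basis" "card S \<ge> 2"
  shows "(\<integral>\<^sup>+x. inverse (ennreal (\<Sum>b\<in>S. \<bar>x \<bullet> b\<bar>)) \<partial>gauss \<mu> \<sigma>)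
    \<le> ennreal (16 / (9 * \<sigma> * (real (card S) - 1)))"
proof -
  interpret prob_space "gauss \<mu> \<sigma>"
    using assms by (intro prob_space_gauss)
  interpret pair_sigma_finite lborel "gauss \<mu> \<sigma>"
    by unfold_locales
  have le: "(\<integral>\<^sup>+x. ennreal (exp (- l * (\<Sum>b\<in>S. \<bar>x \<bullet> b\<bar>))) \<partial>gauss \<mu> \<sigma>)
      \<le> ennreal ((1 / (1 + 9 / 16 * \<sigma> * l)) ^ card S)" if "l > 0" for l
  proof -
    have fin: "finite S"
      using assms(2) by (rule finite_subset) simp
    have Un: "Basis = S \<union> (Basis - S)"
      using assms by auto
    have "(\<integral>\<^sup>+x. ennreal (exp (- l * (\<Sum>b\<in>S. \<bar>x \<bullet> b\<bar>))) \<partial>gauss \<mu> \<sigma>)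
        = (\<integral>\<^sup>+x. (\<Prod>b\<in>Basis. if b \<in> S then ennreal (exp (- l * \<bar>x \<bullet> b\<bar>)) else 1) \<partial>gauss \<mu> \<sigma>)"
      using fin assms
      by (intro nn_integral_cong)
        (simp add: prod.If_cases Int_absorb1 sum_distrib_left exp_sum prod_ennreal flip: sum_negf)
    also have "\<dots> = (\<Prod>b\<in>Basis. \<integral>\<^sup>+y. (if b \<in> S then ennreal (exp (- l * \<bar>y\<bar>)) else 1) \<partial>gauss (\<mu> \<bullet> b) \<sigma>)"
      by (rule nn_integral_gauss_prod[where f="\<lambda>b y. if b \<in> S then ennreal (exp (- l * \<bar>y\<bar>)) else 1"]) simp
    also have "\<dots> \<le> (\<Prod>b\<in>Basis. if b \<in> S then ennreal (1 / (1 + 9 / 16 * \<sigma> * l)) else 1)"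
      using prob_space.emeasure_space_1[OF prob_space_gauss_real[OF \<open>\<sigma> > 0\<close>]] laplace_gauss_le[OF \<open>\<sigma> > 0\<close> that]
      by (intro prod_mono_ennreal) auto
    also have "\<dots> = ennreal ((1 / (1 + 9 / 16 * \<sigma> * l)) ^ card S)"
      using assms that by (simp add: prod.If_cases Int_absorb1 ennreal_power)
    finally show ?thesis .
  qed
  have "(\<integral>\<^sup>+x. inverse (ennreal (\<Sum>b\<in>S. \<bar>x \<bullet> b\<bar>)) \<partial>gauss \<mu> \<sigma>)
      = (\<integral>\<^sup>+x. \<integral>\<^sup>+l. ennreal (exp (- l * (\<Sum>b\<in>S. \<bar>x \<bullet> b\<bar>))) * indicator {0..} l \<partial>lborel \<partial>gauss \<mu> \<sigma>)"
    by (intro nn_integral_cong inverse_eq_nn_integral_exp sum_nonneg) simp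
  also have "\<dots> = (\<integral>\<^sup>+l. \<integral>\<^sup>+x. ennreal (exp (- l * (\<Sum>b\<in>S. \<bar>x \<bullet> b\<bar>))) * indicator {0..} l \<partial>gauss \<mu> \<sigma> \<partial>lborel)"
    by (rule Fubini') measurable
  also have "\<dots> \<le> (\<integral>\<^sup>+l. ennreal ((1 / (1 + 9 / 16 * \<sigma> * l)) ^ card S) * indicator {0..} l \<partial>lborel)"
  proof (rule nn_integral_mono_AE)
    show "AE l in lborel. (\<integral>\<^sup>+x. ennreal (exp (- l * (\<Sum>b\<in>S. \<bar>x \<bullet> b\<bar>))) * indicator {0..} l \<partial>gauss \<mu> \<sigma>)
        \<le> ennreal ((1 / (1 + 9 / 16 * \<sigma> * l)) ^ card S) * indicator {0..} l"
      \<comment> \<open>The bound \<open>le\<close> is available for positive \<open>l\<close>; the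
        remaining point 0 is a null set.\<close>
      using AE_lborel_singleton[of "0::real"]
    proof eventually_elim
      case (elim l)
      then show ?case
        using le[of l] by (cases "l > 0") (auto simp: indicator_def)
    qed
  qed
  also have "\<dots> = ennreal (1 / (9 / 16 * \<sigma> * (real (card S) - 1)))"
    using assms by (intro nn_integral_inverse_power) auto
  also have "1 / (9 / 16 * \<sigma> * (real (card S) - 1)) = 16 / (9 * \<sigma> * (real (card S) - 1))"
    by simp
  finally show ?thesis .
qed

section \<open>LU factorization\<close>

text \<open>The size of a matrix is part of its type, so the block strictly before \<open>k\<close>
  is padded by the identity, which preserves its determinant. For the least index the result is the
  identity matrix.\<close>

definition leading_block :: "'n::{finite,linorder} \<Rightarrow> real^'n::{finite,linorder}^'n::{finite,linorder} \<Rightarrow> real^'n::{finite,linorder}^'n::{finite,linorder}" where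
  "leading_block k A = (\<chi> i j. if i < k \<and> j < k then A $ i $ j else if i = j then 1 else 0)"

definition leading_row :: "'n::{finite,linorder} \<Rightarrow> real^'n::{finite,linorder}^'n::{finite,linorder} \<Rightarrow> real^'n::{finite,linorder}" where
  "leading_row k A = (\<chi> j. if j < k then A $ k $ j else 0)"

text \<open>Up to sign, \<open>y\<close> is the part left of the diagonal in row \<open>k\<close> of
  the inverse of the factor \<open>L\<close>.\<close>

definition eliminates :: "'n::{finite,linorder} \<Rightarrow> real^'n::{finite,linorder}^'n::{finite,linorder} \<Rightarrow> real^'n::{finite,linorder} \<Rightarrow> bool" where
  "eliminates k A y \<longleftrightarrow>
    (\<forall>i. \<not> i < k \<longrightarrow> y $ i = 0) \<and> (\<forall>j<k. (\<Sum>i<k. y $ i * A $ i $ j) = A $ k $ j)"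

text \<open>Cramer's rule keeps the coefficients measurable in \<open>A\<close>.\<close>

definition elim_row :: "'n::{finite,linorder} \<Rightarrow> real^'n::{finite,linorder}^'n::{finite,linorder} \<Rightarrow> real^'n::{finite,linorder}" where
  "elim_row k A = (\<chi> c. det (\<chi> i j. if j = c then leading_row k A $ i else transpose (leading_block k A) $ i $ j)
    / det (leading_block k A))"

lemma leading_block_vec:
  fixes A :: "real^'n::{finite,linorder}^'n::{finite,linorder}"
  shows "(z v* leading_block k A) $ j = (if j < k then \<Sum>i<k. z $ i * A $ i $ j else z $ j)"
proof -
  have "(z v* leading_block k A) $ j
      = (\<Sum>i\<in>UNIV. (if i < k \<and> j < k then A $ i $ j else if i = j then 1 else 0) * z $ i)"
    by (simp add: vector_matrix_mult_def leading_block_def mult.commute)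
  also have "\<dots> = (if j < k then \<Sum>i<k. z $ i * A $ i $ j else z $ j)"
  proof (cases "j < k")
    case True
    then have "(\<Sum>i\<in>UNIV. (if i < k \<and> j < k then A $ i $ j else if i = j then 1 else 0) * z $ i)
        = (\<Sum>i<k. (if i < k \<and> j < k then A $ i $ j else if i = j then 1 else 0) * z $ i)"
      by (intro sum.mono_neutral_right) auto
    with True show ?thesis
      by (simp add: mult.commute)
  qed (simp add: if_distrib[of "\<lambda>u. u * _"] cong: if_cong)
  finally show ?thesis .
qed

text \<open>The identity part of the padded block encodes the support condition on \<open>y\<close>,
  so both conditions become one square linear system.\<close>

lemma eliminates_iff:
  "eliminates k A y \<longleftrightarrow> y v* leading_block k A = leading_row k A"
  by (auto simp: eliminates_def vec_eq_iff leading_block_vec leading_row_def split: if_splits)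

lemma eliminates_unique:
  assumes "det (leading_block k A) \<noteq> 0"
  shows "eliminates k A y \<longleftrightarrow> y = elim_row k A"
  using cramer[of "transpose (leading_block k A)" y "leading_row k A"] assms
  by (simp add: eliminates_iff elim_row_def det_transpose)

text \<open>A kernel vector of the singular system is added. This is what destroys uniqueness of the
  factorization.\<close>

lemma eliminates_add:
  assumes "det (leading_block k A) = 0" "eliminates k A y"
  obtains y' where "eliminates k A y'" "y' \<noteq> y"
proof -
  have "\<not> invertible (transpose (leading_block k A))"
    using assms by (simp add: invertible_det_nz det_transpose)
  then obtain z where z: "transpose (leading_block k A) *v z = 0" "z \<noteq> 0"
    unfolding invertible_left_inverse matrix_left_invertible_ker by blast
  show thesis
  proof
    show "eliminates k A (y + z)"
      using assms z by (simp add: eliminates_iff vector_matrix_left_distrib)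
  qed (use z in auto)
qed

section \<open>Triangular matrices and their inverses\<close>

lemma unit_lower_triangular_mult_vec:
  fixes N :: "real^'n::{finite,linorder}^'n::{finite,linorder}"
  assumes N: "unit_lower_triangular N" and z: "\<And>l. l < i \<Longrightarrow> z $ l = 0"
  shows "(N *v z) $ i = z $ i"
proof -
  have "N $ i $ l * z $ l = (if l = i then z $ i else 0)" for l
    using N z[of l] by (cases l i rule: linorder_cases) (auto simp: unit_lower_triangular_def)
  then show ?thesis
    by (simp add: matrix_vector_mult_def)
qed

lemma minimal_index:
  fixes i :: "'n::{finite,linorder}"
  assumes "P i"
  obtains j where "P j" "\<And>l. l < j \<Longrightarrow> \<not> P l" "j \<le> i"
proof
  let ?j = "Min {j. P j}"
  show "P ?j" using Min_in[of "{j. P j}"] assms by auto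
  show "\<not> P l" if "l < ?j" for l
    using that Min_le[of "{j. P j}" l] by (auto simp: leD)
  show "?j \<le> i"
    using assms by (intro Min_le) auto
qed

text \<open>A vector is tested at its first nonzero entry, which \<open>N\<close> reproduces.
  Applied to a kernel vector this gives injectivity; applied to the columns of the inverse it gives
  their triangular shape and unit diagonal.\<close>

lemma unit_lower_triangular_inverse:
  fixes N :: "real^'n::{finite,linorder}^'n::{finite,linorder}"
  assumes N: "unit_lower_triangular N"
  obtains M where "unit_lower_triangular M" "M ** N = mat 1" "N ** M = mat 1"
proof -
  have "x = 0" if "N *v x = 0" for x
  proof (rule ccontr)
    assume "x \<noteq> 0"
    then obtain i where "x $ i \<noteq> 0"
      by (auto simp: vec_eq_iff)
    then obtain j where j: "x $ j \<noteq> 0" "\<And>l. l < j \<Longrightarrow> \<not> x $ l \<noteq> 0"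
      by (rule minimal_index[where P="\<lambda>i. x $ i \<noteq> 0"]) blast
    with unit_lower_triangular_mult_vec[OF N, of j x] that show False
      by simp
  qed
  then obtain M where M: "M ** N = mat 1"
    using matrix_left_invertible_ker by blast
  then have NM: "N ** M = mat 1"
    by (simp add: matrix_left_right_inverse)
  have col: "(N *v column j M) $ i = (if i = j then 1 else 0)" for i j
  proof -
    have "(N *v column j M) $ i = (N ** M) $ i $ j"
      by (simp add: matrix_vector_mult_def matrix_matrix_mult_def column_def)
    then show ?thesis
      by (simp add: NM mat_def)
  qed
  have zero: "M $ i $ j = 0" if "i < j" for i j
  proof (rule ccontr)
    assume "M $ i $ j \<noteq> 0"
    then obtain i' where i': "M $ i' $ j \<noteq> 0" "\<And>l. l < i' \<Longrightarrow> \<not> M $ l $ j \<noteq> 0" "i' \<le> i"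
      by (rule minimal_index[where P="\<lambda>i. M $ i $ j \<noteq> 0"]) blast
    then show False
      using unit_lower_triangular_mult_vec[OF N, of i' "column j M"] col[of j i'] that
      by (auto simp: column_def split: if_splits)
  qed
  have "M $ j $ j = 1" for j
    using unit_lower_triangular_mult_vec[OF N, of j "column j M"] col[of j j] zero
    by (simp add: column_def)
  with zero have "unit_lower_triangular M"
    by (simp add: unit_lower_triangular_def)
  with M NM show thesis
    using that by blast
qed

lemma left_inverse_unique:
  fixes X :: "real^'b^'b"
  assumes "L ** X = mat 1" "L' ** X = mat 1"
  shows "L = L'"
proof -
  have "X ** L' = mat 1"
    using assms(2) by (simp add: matrix_left_right_inverse)
  then have "L = L ** (X ** L')"
    by simp
  also have "\<dots> = L'"
    by (simp add: matrix_mul_assoc assms(1))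
  finally show ?thesis .
qed

lemma right_inverse_unique:
  fixes L :: "real^'b^'b"
  assumes "L ** X = mat 1" "L ** Y = mat 1"
  shows "X = Y"
  using assms by (intro left_inverse_unique[of X L Y]) (simp_all add: matrix_left_right_inverse)

text \<open>The inverse of \<open>L\<close> written through the elimination coefficients of all
  rows.\<close>

definition elim_matrix :: "('n::{finite,linorder} \<Rightarrow> real^'n::{finite,linorder}) \<Rightarrow> real^'n::{finite,linorder}^'n::{finite,linorder}" where
  "elim_matrix y = (\<chi> k i. if k = i then 1 else - y k $ i)"

lemma elim_matrix_mult:
  fixes A :: "real^'n::{finite,linorder}^'n::{finite,linorder}"
  assumes "\<And>k i. \<not> i < k \<Longrightarrow> y k $ i = 0"
  shows "(elim_matrix y ** A) $ k $ j = A $ k $ j - (\<Sum>i<k. y k $ i * A $ i $ j)"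
proof -
  have "(elim_matrix y ** A) $ k $ j
      = (\<Sum>i\<in>UNIV. (if k = i then A $ i $ j else 0) - (if i < k then y k $ i * A $ i $ j else 0))"
    unfolding matrix_matrix_mult_def elim_matrix_def vec_lambda_beta using assms
    by (intro sum.cong) auto
  also have "\<dots> = A $ k $ j - (\<Sum>i<k. y k $ i * A $ i $ j)"
    by (simp add: sum_subtractf sum.If_cases lessThan_def)
  finally show ?thesis .
qed

lemma unit_lower_triangular_elim_matrix:
  assumes "\<And>k i. \<not> i < k \<Longrightarrow> y k $ i = 0"
  shows "unit_lower_triangular (elim_matrix y)"
  using assms by (auto simp: unit_lower_triangular_def elim_matrix_def)

lemma lu_factorization_elim_matrix:
  assumes y: "\<And>k. eliminates k A (y k)"
  obtains L where "lu_factorization A L (elim_matrix y ** A)" "L ** elim_matrix y = mat 1"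
proof -
  have supp: "y k $ i = 0" if "\<not> i < k" for k i
    using y[of k] that by (simp add: eliminates_def)
  obtain L where L: "unit_lower_triangular L" "L ** elim_matrix y = mat 1"
    by (rule unit_lower_triangular_inverse[OF unit_lower_triangular_elim_matrix[of y, OF supp]]) blast+
  have "upper_triangular (elim_matrix y ** A)"
    using y by (simp add: upper_triangular_def elim_matrix_mult[of y, OF supp] eliminates_def)
  moreover have "A = L ** (elim_matrix y ** A)"
    using L by (simp add: matrix_mul_assoc)
  ultimately show thesis
    using that L by (simp add: lu_factorization_def)
qed

text \<open>The coefficients are read off the inverse of \<open>L\<close>. With the preceding lemma,
  factorizations correspond to families of solutions \<open>y k\<close>, chosen independently for
  each row.\<close>

lemma lu_factorizationE:
  fixes A :: "real^'n::{finite,linorder}^'n::{finite,linorder}"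
  assumes "lu_factorization A L U"
  obtains y where "\<And>k. eliminates k A (y k)" "U = elim_matrix y ** A" "L ** elim_matrix y = mat 1"
proof -
  have L: "unit_lower_triangular L" and U: "upper_triangular U" and A: "A = L ** U"
    using assms by (auto simp: lu_factorization_def)
  obtain N where N: "unit_lower_triangular N" "N ** L = mat 1" "L ** N = mat 1"
    by (rule unit_lower_triangular_inverse[OF L]) blast
  define y where "y = (\<lambda>k. \<chi> i. if i < k then - N $ k $ i else 0)"
  have supp: "y k $ i = 0" if "\<not> i < k" for k i
    using that by (simp add: y_def)
  have "N = elim_matrix y"
    using N(1) by (auto simp: vec_eq_iff elim_matrix_def y_def unit_lower_triangular_def not_less_iff_gr_or_eq)
  have "N ** A = U"
    using N by (simp add: A matrix_mul_assoc)
  then have "eliminates k A (y k)" for k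
    using U elim_matrix_mult[of y A k, OF supp] \<open>N = elim_matrix y\<close>
    by (force simp: eliminates_def supp upper_triangular_def)
  with that[of y] N \<open>N = elim_matrix y\<close> \<open>N ** A = U\<close> show thesis
    by simp
qed

lemma elim_matrix_inject:
  assumes "elim_matrix y = elim_matrix y'" "\<And>k i. \<not> i < k \<Longrightarrow> y k $ i = 0" "\<And>k i. \<not> i < k \<Longrightarrow> y' k $ i = 0"
  shows "y k = y' k"
proof -
  have "y k $ i = y' k $ i" for i
    using assms(1)[THEN arg_cong, of "\<lambda>M. M $ k $ i"] assms(2,3)[where k=k and i=i]
    by (cases "i < k"; cases "k = i") (auto simp: elim_matrix_def)
  then show ?thesis
    by (simp add: vec_eq_iff)
qed

text \<open>Since the rows can be eliminated independently, uniqueness means that each of the linear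
  systems has exactly one solution. Only blocks strictly before an index occur, so \<open>A\<close>
  itself may be singular.\<close>

lemma has_unique_lu_iff:
  fixes A :: "real^'n::{finite,linorder}^'n::{finite,linorder}"
  shows "has_unique_lu A \<longleftrightarrow> (\<forall>k. det (leading_block k A) \<noteq> 0)" (is "?l \<longleftrightarrow> ?r")
    and lu_upper_eq: "has_unique_lu A \<Longrightarrow> lu_upper A = elim_matrix (\<lambda>k. elim_row k A) ** A"
proof -
  show *: "?l \<longleftrightarrow> ?r"
  proof
    assume ?l
    show ?r
    proof (intro allI notI)
      fix k assume det: "det (leading_block k A) = 0"
      from \<open>?l\<close> obtain L U where LU: "lu_factorization A L U"
        and unique: "\<And>L' U'. lu_factorization A L' U' \<Longrightarrow> L' = L"
        unfolding has_unique_lu_def Ex1_def by auto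
      obtain y where y: "\<And>k. eliminates k A (y k)" "L ** elim_matrix y = mat 1"
        using LU by (rule lu_factorizationE) blast
      obtain z where z: "eliminates k A z" "z \<noteq> y k"
        using eliminates_add[OF det y(1)] by blast
      have yz: "eliminates l A ((y(k := z)) l)" for l
        using y z by simp
      obtain L' where L': "lu_factorization A L' (elim_matrix (y(k := z)) ** A)" "L' ** elim_matrix (y(k := z)) = mat 1"
        using lu_factorization_elim_matrix[of A "y(k := z)", OF yz] by blast
      have "elim_matrix y = elim_matrix (y(k := z))"
        \<comment> \<open>Uniqueness identifies \<open>L'\<close> with \<open>L\<close>, and then
          both elimination matrices are right inverses of the same matrix although they differ in
          row \<open>k\<close>.\<close>
        using L'(2) unfolding unique[OF L'(1)] by (rule right_inverse_unique[OF y(2)])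
      then have "y k = (y(k := z)) k"
        using y(1) yz by (intro elim_matrix_inject[of y "y(k := z)"]) (simp_all only: eliminates_def, blast+)
      with z show False by simp
    qed
  next
    assume ?r
    then have elim: "eliminates k A (elim_row k A)" for k
      by (simp add: eliminates_unique)
    obtain L where L: "lu_factorization A L (elim_matrix (\<lambda>k. elim_row k A) ** A)"
      "L ** elim_matrix (\<lambda>k. elim_row k A) = mat 1"
      by (rule lu_factorization_elim_matrix[of A "\<lambda>k. elim_row k A", OF elim])
    have "L' = L \<and> U' = elim_matrix (\<lambda>k. elim_row k A) ** A" if "lu_factorization A L' U'" for L' U'
    proof -
      obtain y where y: "\<And>k. eliminates k A (y k)" "U' = elim_matrix y ** A" "L' ** elim_matrix y = mat 1"
        using \<open>lu_factorization A L' U'\<close> by (rule lu_factorizationE) blast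
      have "y = (\<lambda>k. elim_row k A)"
        using y(1) \<open>?r\<close> eliminates_unique by (intro ext) blast
      with y(2,3) show ?thesis
        using left_inverse_unique[OF y(3)] L(2) by simp
    qed
    then have "LU = (L, elim_matrix (\<lambda>k. elim_row k A) ** A)" if "lu_factorization A (fst LU) (snd LU)" for LU
      using that by (simp add: prod_eq_iff)
    with L(1) show ?l
      unfolding has_unique_lu_def by (intro ex1I[of _ "(L, elim_matrix (\<lambda>k. elim_row k A) ** A)"]) simp_all
  qed
  show "lu_upper A = elim_matrix (\<lambda>k. elim_row k A) ** A" if "has_unique_lu A"
  proof -
    have r: "\<forall>k. det (leading_block k A) \<noteq> 0"
      using that * by simp
    then have elim: "eliminates k A (elim_row k A)" for k
      by (simp add: eliminates_unique)
    show ?thesis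
      unfolding lu_upper_def
    proof (rule the_equality)
      show "\<exists>L. lu_factorization A L (elim_matrix (\<lambda>k. elim_row k A) ** A)"
        by (rule lu_factorization_elim_matrix[of A "\<lambda>k. elim_row k A", OF elim]) blast
      fix U assume "\<exists>L. lu_factorization A L U"
      then obtain L where "lu_factorization A L U" ..
      then obtain y where y: "\<And>k. eliminates k A (y k)" "U = elim_matrix y ** A"
        by (rule lu_factorizationE) blast
      then have "y = (\<lambda>k. elim_row k A)"
        using r eliminates_unique by (intro ext) blast
      with y show "U = elim_matrix (\<lambda>k. elim_row k A) ** A"
        by simp
    qed
  qed
qed

section \<open>From the growth factor to updates of single rows\<close>

lemma row_sum_le_matrix_norm_inf: "(\<Sum>j\<in>UNIV. \<bar>A $ i $ j\<bar>) \<le> matrix_norm_inf A"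
  unfolding matrix_norm_inf_def by (intro Max_ge) auto

lemma matrix_norm_inf_attained: "\<exists>i. matrix_norm_inf A = (\<Sum>j\<in>UNIV. \<bar>A $ i $ j\<bar>)"
proof -
  have "matrix_norm_inf A \<in> range (\<lambda>i. \<Sum>j\<in>UNIV. \<bar>A $ i $ j\<bar>)"
    unfolding matrix_norm_inf_def by (intro Max_in) auto
  then show ?thesis by auto
qed

text \<open>This is W_k of the overview. Through Cramer's rule it is defined for every matrix; it
  has its meaning only when the leading block is nonsingular.\<close>

definition update_sum :: "'n::{finite,linorder} \<Rightarrow> real^'n::{finite,linorder}^'n::{finite,linorder} \<Rightarrow> real" where
  "update_sum k A = (\<Sum>j\<in>{k..}. \<bar>\<Sum>i<k. elim_row k A $ i * A $ i $ j\<bar>)"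

text \<open>The row \<open>k\<close> that attains the norm of the upper factor works: its own
  entries in \<open>A\<close> account for at most the norm of \<open>A\<close>, so the update must
  account for the rest. The row \<open>l\<close> serves only as a lower bound for that norm and can
  be chosen freely.\<close>

lemma growth_factor_gt:
  fixes A :: "real^'n::{finite,linorder}^'n::{finite,linorder}"
  assumes "growth_factor A > 1 + x" "x > 0"
  shows "\<exists>k. det (leading_block k A) \<noteq> 0 \<and> x * (\<Sum>j\<in>UNIV. \<bar>A $ l $ j\<bar>) < update_sum k A"
proof -
  have lu: "has_unique_lu A" and g: "matrix_norm_inf (lu_upper A) / matrix_norm_inf A > 1 + x"
    using assms by (auto simp: growth_factor_def split: if_splits)
  have det: "\<forall>k. det (leading_block k A) \<noteq> 0"
    using lu has_unique_lu_iff by blast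
  then have elim: "eliminates k A (elim_row k A)" for k
    by (simp add: eliminates_unique)
  have "matrix_norm_inf A \<ge> 0"
    by (rule order_trans[OF _ row_sum_le_matrix_norm_inf[of A l]]) (simp add: sum_nonneg)
  \<comment> \<open>For norm zero the quotient would be 0 by the division convention, against
    \<open>g\<close>.\<close>
  with g assms(2) have pos: "matrix_norm_inf A > 0"
    by (cases "matrix_norm_inf A = 0") auto
  obtain k where k: "matrix_norm_inf (lu_upper A) = (\<Sum>j\<in>UNIV. \<bar>lu_upper A $ k $ j\<bar>)"
    using matrix_norm_inf_attained by blast
  let ?s = "\<lambda>j. \<Sum>i<k. elim_row k A $ i * A $ i $ j"
  have U: "lu_upper A $ k $ j = A $ k $ j - ?s j" for j
    using elim by (subst lu_upper_eq[OF lu]) (simp add: elim_matrix_mult eliminates_def)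
  have "(\<Sum>j\<in>UNIV. \<bar>lu_upper A $ k $ j\<bar>) \<le> (\<Sum>j\<in>UNIV. \<bar>A $ k $ j\<bar> + (if k \<le> j then \<bar>?s j\<bar> else 0))"
  proof (rule sum_mono)
    fix j
    show "\<bar>lu_upper A $ k $ j\<bar> \<le> \<bar>A $ k $ j\<bar> + (if k \<le> j then \<bar>?s j\<bar> else 0)"
      using elim[of k] by (cases "j < k") (auto simp: U eliminates_def)
  qed
  also have "\<dots> = (\<Sum>j\<in>UNIV. \<bar>A $ k $ j\<bar>) + update_sum k A"
    by (simp add: sum.distrib update_sum_def sum.If_cases atLeast_def)
  finally have "matrix_norm_inf (lu_upper A) \<le> matrix_norm_inf A + update_sum k A"
    using row_sum_le_matrix_norm_inf[of A k] k by linarith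
  moreover have "(1 + x) * matrix_norm_inf A < matrix_norm_inf (lu_upper A)"
    using g pos by (simp add: field_simps)
  moreover have "x * (\<Sum>j\<in>UNIV. \<bar>A $ l $ j\<bar>) \<le> x * matrix_norm_inf A"
    using assms(2) by (intro mult_left_mono row_sum_le_matrix_norm_inf) auto
  ultimately have "x * (\<Sum>j\<in>UNIV. \<bar>A $ l $ j\<bar>) < update_sum k A"
    by (simp add: distrib_right)
  with det show ?thesis by blast
qed

section \<open>Measurability of the growth factor\<close>

lemma borel_measurable_matrix_nth [measurable]: "(\<lambda>A::real^'b^'c. A $ i $ j) \<in> borel_measurable borel"
  by (intro borel_measurable_continuous_onI continuous_intros)

lemma borel_measurable_det [measurable (raw)]:
  fixes f :: "'a \<Rightarrow> real^'b^'b"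
  assumes "\<And>i j. (\<lambda>x. f x $ i $ j) \<in> borel_measurable M"
  shows "(\<lambda>x. det (f x)) \<in> borel_measurable M"
  unfolding det_def using assms by measurable

lemma borel_measurable_det_leading_block [measurable]:
  "(\<lambda>A. det (leading_block k A)) \<in> borel_measurable borel"
  by (rule borel_measurable_det) (auto simp: leading_block_def)

lemma borel_measurable_elim_row [measurable]: "(\<lambda>A. elim_row k A $ i) \<in> borel_measurable borel"
proof -
  have "(\<lambda>A. det (\<chi> r c. if c = i then leading_row k A $ r else transpose (leading_block k A) $ r $ c))
      \<in> borel_measurable borel"
    by (rule borel_measurable_det)
      (unfold leading_block_def leading_row_def Finite_Cartesian_Product.transpose_def vec_lambda_beta, measurable)
  then show ?thesis
    unfolding elim_row_def by simp
qed

lemma borel_measurable_update_sum [measurable]: "update_sum k \<in> borel_measurable borel"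
  unfolding update_sum_def[abs_def] by measurable

lemma borel_measurable_matrix_norm_inf:
  fixes f :: "'a \<Rightarrow> real^'b^'c"
  assumes [measurable]: "\<And>i j. (\<lambda>x. f x $ i $ j) \<in> borel_measurable M"
  shows "(\<lambda>x. matrix_norm_inf (f x)) \<in> borel_measurable M"
  unfolding matrix_norm_inf_def by measurable

text \<open>The existence guard and the description operator are replaced by expressions in
  determinants, which are measurable in the entries.\<close>

lemma borel_measurable_growth_factor [measurable]:
  "(growth_factor :: real^'n::{finite,linorder}^'n::{finite,linorder} \<Rightarrow> real) \<in> borel_measurable borel"
proof -
  have eq: "growth_factor A = (if \<forall>k. det (leading_block k A) \<noteq> 0
      then matrix_norm_inf (elim_matrix (\<lambda>k. elim_row k A) ** A) / matrix_norm_inf A else 0)"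
    for A :: "real^'n::{finite,linorder}^'n::{finite,linorder}"
    using has_unique_lu_iff[of A] lu_upper_eq[of A] by (auto simp: growth_factor_def)
  have [measurable]: "(\<lambda>A::real^'n::{finite,linorder}^'n::{finite,linorder}. matrix_norm_inf A) \<in> borel_measurable borel"
    by (rule borel_measurable_matrix_norm_inf) measurable
  have [measurable]: "(\<lambda>A::real^'n::{finite,linorder}^'n::{finite,linorder}. matrix_norm_inf (elim_matrix (\<lambda>k. elim_row k A) ** A)) \<in> borel_measurable borel"
    by (rule borel_measurable_matrix_norm_inf) (simp add: matrix_matrix_mult_def elim_matrix_def if_distrib[of "\<lambda>u. u * _"] cong: if_cong)
  show ?thesis
    unfolding eq[abs_def] by measurable
qed

section \<open>The update of one row of the upper factor\<close>

text \<open>Translates a predicate on matrix positions into a set of basis vectors, the form in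
  which \<open>mix\<close> expects its coordinates.\<close>

definition cells :: "('n \<Rightarrow> 'm \<Rightarrow> bool) \<Rightarrow> (real^'m^'n) set" where
  "cells P = {axis i (axis j 1) | i j. P i j}"

lemma axis_axis_in_Basis: "axis i (axis j 1) \<in> (Basis :: (real^'m^'n) set)"
  by (auto simp: Basis_vec_def)

lemma cells_subset_Basis: "cells P \<subseteq> Basis"
  by (auto simp: cells_def axis_axis_in_Basis)

lemma axis_axis_in_cells [simp]: "axis i (axis j 1) \<in> cells P \<longleftrightarrow> P i j"
  by (auto simp: cells_def axis_eq_axis)

lemma Basis_matrixE:
  assumes "b \<in> (Basis :: (real^'m^'n) set)"
  obtains i j where "b = axis i (axis j 1)"
  using assms by (auto simp: Basis_vec_def)

lemma inner_axis_axis: "(X :: real^'m^'n) \<bullet> axis i (axis j 1) = X $ i $ j"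
  by (simp add: inner_axis)

lemma bij_betw_matrix_Basis:
  "bij_betw (\<lambda>(i, j). axis i (axis j 1)) (UNIV :: ('n::finite \<times> 'm::finite) set) (Basis :: (real^'m^'n) set)"
  unfolding bij_betw_def
  by (auto simp: inj_on_def axis_eq_axis axis_axis_in_Basis image_iff elim!: Basis_matrixE)

lemma mix_cells:
  "mix (cells P) X Y $ i $ j = (if P i j then Y $ i $ j else X $ i $ j)"
  using inner_mix[OF axis_axis_in_Basis[of i j], of "cells P" X Y] by (simp add: inner_axis_axis)

text \<open>Row \<open>k\<close> is left alone: its direction determines \<open>v\<close>. The map
  is an isometry of the space of matrices and its own inverse.\<close>

definition reflect_rows :: "real^'n::{finite,linorder} \<Rightarrow> 'n::{finite,linorder} \<Rightarrow> real^'n::{finite,linorder}^'n::{finite,linorder} \<Rightarrow> real^'n::{finite,linorder}^'n::{finite,linorder}" where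
  "reflect_rows v k X = (\<chi> i. if i < k then reflection v (X $ i) else X $ i)"

lemma linear_reflect_rows: "linear (reflect_rows v k)"
  by (rule linearI)
    (auto simp: reflect_rows_def vec_eq_iff linear_add[OF linear_reflection] linear_cmul[OF linear_reflection])

lemma norm_reflect_rows: "norm (reflect_rows v k X) = norm X"
  unfolding norm_vec_def[where x="reflect_rows v k X"] norm_vec_def[where x=X]
  by (intro L2_set_cong) (auto simp: reflect_rows_def norm_reflection)

lemma reflect_rows_reflect_rows: "reflect_rows v k (reflect_rows v k X) = X"
  by (simp add: reflect_rows_def vec_eq_iff reflection_reflection)

text \<open>Erasing column \<open>l\<close> makes the padded block singular, and a left kernel
  vector is orthogonal to all its other columns. The identity columns of the padding force the
  vector to vanish from \<open>k\<close> on.\<close>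

lemma exists_unit_annihilator:
  fixes X :: "real^'n::{finite,linorder}^'n::{finite,linorder}"
  assumes "l < k"
  obtains t :: "real^'n::{finite,linorder}" where "norm t = 1" "\<And>i. \<not> i < k \<Longrightarrow> t $ i = 0"
    "\<And>j. j < k \<Longrightarrow> j \<noteq> l \<Longrightarrow> (\<Sum>i<k. t $ i * X $ i $ j) = 0"
proof -
  define B where "B = (\<chi> i j. if j = l then 0 else leading_block k X $ i $ j)"
  have "column l B = 0"
    by (simp add: B_def column_def vec_eq_iff)
  then have "det B = 0"
    by (rule det_zero_column)
  then have "\<not> invertible (transpose B)"
    by (simp add: invertible_det_nz det_transpose)
  then obtain z where z: "z v* B = 0" "z \<noteq> 0"
    unfolding invertible_left_inverse matrix_left_invertible_ker by auto
  have *: "(z v* B) $ j = (z v* leading_block k X) $ j" if "j \<noteq> l" for j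
    using that by (simp add: vector_matrix_mult_def B_def)
  show thesis
  proof
    show "norm (z /\<^sub>R norm z) = 1"
      using z by simp
    show "(z /\<^sub>R norm z) $ i = 0" if "\<not> i < k" for i
    proof -
      have "i \<noteq> l" using that assms by auto
      then show ?thesis
        using *[of i] that z by (simp add: leading_block_vec)
    qed
    show "(\<Sum>i<k. (z /\<^sub>R norm z) $ i * X $ i $ j) = 0" if "j < k" "j \<noteq> l" for j
      using *[of j] that z by (simp add: leading_block_vec mult.assoc flip: sum_distrib_left)
  qed
qed

text \<open>The vectors \<open>c *\<^sub>R t\<close> and \<open>\<tau> *\<^sub>R y\<close> solve the
  same nonsingular system and hence coincide, so the inverse of the block enters only through the
  scalar \<open>\<tau>\<close>. It is nonzero because \<open>t\<close> is.\<close>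

lemma update_sum_eq:
  fixes Z :: "real^'n::{finite,linorder}^'n::{finite,linorder}"
  assumes det: "det (leading_block k Z) \<noteq> 0" and t: "norm t = 1" "\<And>i. \<not> i < k \<Longrightarrow> t $ i = 0"
    and a: "c > 0" "\<And>j. j < k \<Longrightarrow> c * (\<Sum>i<k. t $ i * Z $ i $ j) = \<tau> * Z $ k $ j"
  shows "\<tau> \<noteq> 0" "\<bar>\<tau>\<bar> * update_sum k Z = c * (\<Sum>j\<in>{k..}. \<bar>\<Sum>i<k. t $ i * Z $ i $ j\<bar>)"
proof -
  define y where "y = elim_row k Z"
  have y: "eliminates k Z y"
    using det by (simp add: y_def eliminates_unique)
  define z where "z = c *\<^sub>R t - \<tau> *\<^sub>R y"
  have supp: "z $ j = 0" if "\<not> j < k" for j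
    using that t y by (simp add: z_def eliminates_def)
  have "(z v* leading_block k Z) $ j = 0" for j
  proof (cases "j < k")
    case True
    have "(\<Sum>i<k. z $ i * Z $ i $ j) = c * (\<Sum>i<k. t $ i * Z $ i $ j) - \<tau> * (\<Sum>i<k. y $ i * Z $ i $ j)"
      by (simp add: z_def sum_distrib_left algebra_simps flip: sum_subtractf)
    then show ?thesis
      using True a y by (simp add: leading_block_vec eliminates_def)
  qed (simp add: leading_block_vec supp)
  then have "transpose (leading_block k Z) *v z = 0"
    by (simp add: vec_eq_iff)
  moreover have "invertible (transpose (leading_block k Z))"
    using det by (simp add: invertible_det_nz det_transpose)
  ultimately have "z = 0"
    unfolding invertible_left_inverse matrix_left_invertible_ker by blast
  then have eq: "c *\<^sub>R t = \<tau> *\<^sub>R y"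
    by (simp add: z_def)
  show "\<tau> \<noteq> 0"
    using eq a t by auto
  have "\<bar>\<tau>\<bar> * \<bar>\<Sum>i<k. y $ i * Z $ i $ j\<bar> = c * \<bar>\<Sum>i<k. t $ i * Z $ i $ j\<bar>" for j
  proof -
    have "\<tau> * (\<Sum>i<k. y $ i * Z $ i $ j) = (\<Sum>i<k. (\<tau> *\<^sub>R y) $ i * Z $ i $ j)"
      by (simp add: sum_distrib_left mult.assoc)
    also have "\<dots> = c * (\<Sum>i<k. t $ i * Z $ i $ j)"
      unfolding eq[symmetric] by (simp add: sum_distrib_left mult.assoc)
    finally have "\<bar>\<tau> * (\<Sum>i<k. y $ i * Z $ i $ j)\<bar> = \<bar>c * (\<Sum>i<k. t $ i * Z $ i $ j)\<bar>"
      by simp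
    then show ?thesis
      using a(1) by (simp add: abs_mult)
  qed
  then show "\<bar>\<tau>\<bar> * update_sum k Z = c * (\<Sum>j\<in>{k..}. \<bar>\<Sum>i<k. t $ i * Z $ i $ j\<bar>)"
    by (simp add: update_sum_def y_def[symmetric] sum_distrib_left)
qed

text \<open>Covers the case in which row \<open>k\<close> supplies no direction to rotate.\<close>

lemma update_sum_zero_row:
  assumes "det (leading_block k Z) \<noteq> 0" "leading_row k Z = 0"
  shows "update_sum k Z = 0"
proof -
  have "eliminates k Z 0"
    using assms(2) by (simp add: eliminates_iff)
  then have "elim_row k Z = 0"
    using eliminates_unique[OF assms(1), of 0] by simp
  then show ?thesis
    by (simp add: update_sum_def)
qed

text \<open>The product of \<open>t\<close> with column \<open>l\<close> as an inner product on the
  space of matrices, so that the lemmas on Gaussian inner products apply.\<close>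

definition column_functional :: "'m \<Rightarrow> real^'n \<Rightarrow> real^'m^'n" where
  "column_functional l t = (\<chi> i j. if j = l then t $ i else 0)"

lemma inner_column_functional: "column_functional l t \<bullet> X = (\<Sum>i\<in>UNIV. t $ i * X $ i $ l)"
  by (simp add: column_functional_def inner_vec_def if_distrib[of "\<lambda>u. u * _"] cong: if_cong)

lemma norm_column_functional: "norm (column_functional l t) = norm t"
proof -
  have "column_functional l t \<bullet> column_functional l t = t \<bullet> t"
    by (simp add: inner_column_functional) (simp add: column_functional_def inner_vec_def)
  then show ?thesis
    by (simp add: norm_eq_sqrt_inner)
qed

text \<open>Replaces an absolute value by a square with a free scale \<open>s\<close>. Optimizing
  \<open>s\<close> after integration gives the square root bound that Jensen's inequality would
  give.\<close>

lemma abs_le_AM_GM: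
  fixes s z :: real
  assumes "s > 0"
  shows "\<bar>z\<bar> \<le> s / 2 + z\<^sup>2 / (2 * s)"
proof -
  have "0 \<le> (s - \<bar>z\<bar>)\<^sup>2" by simp
  then have "2 * s * \<bar>z\<bar> \<le> s\<^sup>2 + z\<^sup>2"
    by (simp add: power2_diff)
  then show ?thesis
    using assms by (simp add: field_simps power2_eq_square)
qed

text \<open>One common scale for all columns reduces the claim to second moments, where the squared
  means add up to at most 1 and each variance contributes \<open>\<sigma>\<^sup>2\<close>.\<close>

lemma nn_integral_gauss_column_sum:
  fixes \<mu> :: "real^'m^'n"
  assumes "\<sigma> > 0" "norm t = 1" "J \<noteq> {}"
    and mean: "(\<Sum>j\<in>J. (\<Sum>i\<in>UNIV. t $ i * \<mu> $ i $ j)\<^sup>2) \<le> 1"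
  shows "(\<integral>\<^sup>+X. ennreal (\<Sum>j\<in>J. \<bar>\<Sum>i\<in>UNIV. t $ i * X $ i $ j\<bar>) \<partial>gauss \<mu> \<sigma>)
    \<le> ennreal (sqrt (real (card J) * (1 + real (card J) * \<sigma>\<^sup>2)))"
proof -
  interpret prob_space "gauss \<mu> \<sigma>"
    using assms by (intro prob_space_gauss)
  define m where "m = real (card J)"
  have m: "m > 0"
    using assms(3) finite[of J] by (simp add: m_def card_gt_0_iff)
  \<comment> \<open>The minimizer of
    \<open>m * s / 2 + (1 + m * \<sigma>\<^sup>2) / (2 * s)\<close>; the minimum is
    \<open>m * s\<close>.\<close>
  define s where "s = sqrt ((1 + m * \<sigma>\<^sup>2) / m)"
  have "s > 0" and s2: "s * s = (1 + m * \<sigma>\<^sup>2) / m"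
    using m by (auto simp: s_def add_pos_nonneg)
  have [measurable]: "(\<lambda>X::real^'m^'n. X $ i $ j) \<in> borel_measurable borel" for i j
    by (rule borel_measurable_matrix_nth)
  let ?z = "\<lambda>j X. \<Sum>i\<in>UNIV. t $ i * X $ i $ j"
  have sq: "(\<integral>\<^sup>+X. ennreal ((?z j X)\<^sup>2) \<partial>gauss \<mu> \<sigma>) = ennreal ((?z j \<mu>)\<^sup>2 + \<sigma>\<^sup>2)" for j
    using nn_integral_gauss_inner_power2[of "column_functional j t" \<sigma> \<mu>] assms(1,2)
    by (simp add: norm_column_functional inner_column_functional)
  have "(\<integral>\<^sup>+X. ennreal (\<Sum>j\<in>J. \<bar>?z j X\<bar>) \<partial>gauss \<mu> \<sigma>)
      \<le> (\<integral>\<^sup>+X. (\<Sum>j\<in>J. ennreal (s / 2) + ennreal (1 / (2 * s)) * ennreal ((?z j X)\<^sup>2)) \<partial>gauss \<mu> \<sigma>)"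
  proof (rule nn_integral_mono)
    fix X :: "real^'m^'n"
    have "ennreal (\<Sum>j\<in>J. \<bar>?z j X\<bar>) \<le> ennreal (\<Sum>j\<in>J. s / 2 + 1 / (2 * s) * (?z j X)\<^sup>2)"
      using abs_le_AM_GM[OF \<open>s > 0\<close>] by (intro ennreal_leI sum_mono) simp
    also have "\<dots> = (\<Sum>j\<in>J. ennreal (s / 2) + ennreal (1 / (2 * s)) * ennreal ((?z j X)\<^sup>2))"
      using \<open>s > 0\<close> by (subst sum_ennreal[symmetric])
        (auto intro!: sum.cong add_nonneg_nonneg mult_nonneg_nonneg simp: ennreal_plus ennreal_mult simp del: times_divide_eq_left)
    finally show "ennreal (\<Sum>j\<in>J. \<bar>?z j X\<bar>) \<le> (\<Sum>j\<in>J. ennreal (s / 2) + ennreal (1 / (2 * s)) * ennreal ((?z j X)\<^sup>2))" .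
  qed
  also have "\<dots> = (\<Sum>j\<in>J. ennreal (s / 2) + ennreal (1 / (2 * s)) * ennreal ((?z j \<mu>)\<^sup>2 + \<sigma>\<^sup>2))"
    using emeasure_space_1 by (simp add: nn_integral_sum nn_integral_add nn_integral_cmult sq)
  also have "\<dots> = ennreal (\<Sum>j\<in>J. s / 2 + 1 / (2 * s) * ((?z j \<mu>)\<^sup>2 + \<sigma>\<^sup>2))"
    using \<open>s > 0\<close> by (subst sum_ennreal[symmetric])
      (auto intro!: sum.cong add_nonneg_nonneg mult_nonneg_nonneg simp: ennreal_plus ennreal_mult simp del: times_divide_eq_left)
  also have "\<dots> \<le> ennreal (sqrt (m * (1 + m * \<sigma>\<^sup>2)))"
  proof (rule ennreal_leI)
    have "(\<Sum>j\<in>J. s / 2 + 1 / (2 * s) * ((?z j \<mu>)\<^sup>2 + \<sigma>\<^sup>2))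
        = m * (s / 2) + 1 / (2 * s) * ((\<Sum>j\<in>J. (?z j \<mu>)\<^sup>2) + m * \<sigma>\<^sup>2)"
      unfolding sum.distrib sum_distrib_left[symmetric] by (simp add: m_def)
    also have "\<dots> \<le> m * (s / 2) + 1 / (2 * s) * (1 + m * \<sigma>\<^sup>2)"
      using mean \<open>s > 0\<close> by (intro add_left_mono mult_left_mono) auto
    also have "1 + m * \<sigma>\<^sup>2 = m * (s * s)"
      using m by (simp add: s2)
    also have "m * (s / 2) + 1 / (2 * s) * (m * (s * s)) = m * s"
      using \<open>s > 0\<close> by (simp add: field_simps)
    also have "m * s = sqrt (m * (1 + m * \<sigma>\<^sup>2))"
    proof (rule sym, rule real_sqrt_unique)
      show "(m * s)\<^sup>2 = m * (1 + m * \<sigma>\<^sup>2)"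
        using m by (simp add: power2_eq_square mult.assoc mult.left_commute[of s] s2)
    qed (use m \<open>s > 0\<close> in auto)
    finally show "(\<Sum>j\<in>J. s / 2 + 1 / (2 * s) * ((?z j \<mu>)\<^sup>2 + \<sigma>\<^sup>2)) \<le> sqrt (m * (1 + m * \<sigma>\<^sup>2))" .
  qed
  finally show ?thesis
    by (simp add: m_def)
qed

lemma reflect_rows_column_sum:
  fixes X :: "real^'n::{finite,linorder}^'n::{finite,linorder}"
  assumes "\<And>i. \<not> i < k \<Longrightarrow> t $ i = 0"
  shows "(\<Sum>i<k. t $ i * reflect_rows v k X $ i $ j) = reflection v (\<Sum>i<k. t $ i *\<^sub>R X $ i) $ j"
proof -
  have "reflection v (\<Sum>i<k. t $ i *\<^sub>R X $ i) = (\<Sum>i<k. t $ i *\<^sub>R reflection v (X $ i))"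
    by (simp add: linear_sum[OF linear_reflection] linear_cmul[OF linear_reflection])
  then show ?thesis
    by (simp add: reflect_rows_def)
qed

text \<open>On the support of \<open>a - axis l 1\<close> the vector \<open>r\<close> agrees with a
  multiple of the axis. The difference is therefore orthogonal to the reflecting vector and fixed,
  while the axis is exchanged with \<open>a\<close>.\<close>

lemma reflection_axis_shift:
  fixes r :: "real^'n"
  assumes "norm a = 1" and r: "\<And>j. (a - axis l 1) $ j \<noteq> 0 \<Longrightarrow> r $ j = (\<tau> *\<^sub>R axis l 1) $ j"
  shows "reflection (a - axis l 1) r = r - \<tau> *\<^sub>R axis l 1 + \<tau> *\<^sub>R a"
proof -
  let ?v = "a - axis l 1" and ?e = "axis l 1 :: real^'n"
  have "?v \<bullet> (r - \<tau> *\<^sub>R ?e) = 0"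
    unfolding inner_vec_def using r by (intro sum.neutral) force
  then have "reflection ?v (r - \<tau> *\<^sub>R ?e) = r - \<tau> *\<^sub>R ?e"
    by (simp add: reflection_def)
  moreover have "reflection ?v ?e = a"
    using reflection_reflection[of ?v a] reflection_swap[of a ?e] assms(1) by simp
  ultimately show ?thesis
    using linear_add[OF linear_reflection, of ?v "r - \<tau> *\<^sub>R ?e" "\<tau> *\<^sub>R ?e"]
    by (simp add: linear_cmul[OF linear_reflection])
qed

lemma sum_lessThan_supp:
  fixes t :: "real^'n::{finite,linorder}"
  assumes "\<And>i. \<not> i < k \<Longrightarrow> t $ i = 0"
  shows "(\<Sum>i<k. t $ i * f i) = (\<Sum>i\<in>UNIV. t $ i * f i)"
  using assms by (intro sum.mono_neutral_left) auto

lemma emeasure_update_sum_fixed: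
  fixes A \<mu> :: "real^'n::{finite,linorder}^'n::{finite,linorder}" and k :: 'n
  assumes \<sigma>: "\<sigma> > 0" and x: "x > 0" and ok: "p < k" and d: "d > 0" and a: "leading_row k A \<noteq> 0"
    and mean: "\<And>t. norm t = 1 \<Longrightarrow> (\<Sum>j\<in>{k..}. (\<Sum>i\<in>UNIV. t $ i * \<mu> $ i $ j)\<^sup>2) \<le> 1"
  defines "E \<equiv> {Z. det (leading_block k Z) \<noteq> 0 \<and> x * d < update_sum k Z}"
  shows "(\<integral>\<^sup>+X. indicator E (mix (cells (\<lambda>i j. i < k)) A X) \<partial>gauss \<mu> \<sigma>)
    \<le> ennreal (sqrt (2 / pi) / (\<sigma> * x) * sqrt (real (card {k..}) * (1 + real (card {k..}) * \<sigma>\<^sup>2))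
        * norm (leading_row k A) / d)"
proof -
  define c where "c = norm (leading_row k A)"
  have c: "c > 0"
    using a by (simp add: c_def)
  define a1 where "a1 = leading_row k A /\<^sub>R c"
  have a1: "norm a1 = 1"
    using c by (simp add: a1_def c_def)
  have a1_supp: "a1 $ j = (if j < k then A $ k $ j / c else 0)" for j
    by (simp add: a1_def leading_row_def divide_inverse)
  \<comment> \<open>Reflecting in \<open>v\<close> exchanges the direction of row \<open>k\<close>
    with the axis \<open>p\<close>. Both are supported before \<open>k\<close>, hence so is
    \<open>v\<close>.\<close>
  define v where "v = a1 - axis p 1"
  have v_supp: "v $ j = 0" if "\<not> j < k" for j
    using that ok by (auto simp: v_def a1_supp axis_def)
  let ?\<Phi> = "reflect_rows v k"
  \<comment> \<open>\<open>?R\<close> holds the random rows. \<open>?Q\<close> is what the inner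
    integral resamples: column \<open>p\<close>, which carries \<open>\<tau>\<close>, and the
    columns from \<open>k\<close> on, which carry \<open>H\<close>; the block columns left frozen
    determine \<open>t\<close>. \<open>?S\<close> singles out column \<open>p\<close>, separating
    \<open>\<tau>\<close> from \<open>H\<close>.\<close>
  let ?R = "cells (\<lambda>i j. i < k) :: (real^'n::{finite,linorder}^'n::{finite,linorder}) set"
  let ?Q = "cells (\<lambda>i j. j = p \<or> k \<le> j) :: (real^'n::{finite,linorder}^'n::{finite,linorder}) set"
  let ?S = "cells (\<lambda>i j. j = p) :: (real^'n::{finite,linorder}^'n::{finite,linorder}) set"
  define H where "H = (\<lambda>t (X::real^'n::{finite,linorder}^'n::{finite,linorder}). \<Sum>j\<in>{k..}. \<bar>\<Sum>i\<in>UNIV. t $ i * X $ i $ j\<bar>)"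
  define b where "b = sqrt (real (card {k..}) * (1 + real (card {k..}) * \<sigma>\<^sup>2))"
  have E [measurable]: "E \<in> sets borel"
    unfolding E_def by measurable
  have [measurable]: "?\<Phi> \<in> borel_measurable borel"
    by (intro measurable_linear linear_reflect_rows)
  have [measurable]: "mix ?R A \<in> borel_measurable borel"
    unfolding mix_def[abs_def] by measurable
  have [measurable]: "H t \<in> borel_measurable borel" for t
    unfolding H_def by measurable

  \<comment> \<open>In rotated coordinates \<open>t\<close> maps the block to \<open>\<tau>\<close>
    times the axis \<open>p\<close>; reflecting back gives \<open>\<tau>\<close> times the direction
    of row \<open>k\<close>, which is the hypothesis of \<open>update_sum_eq\<close>. Multiplying by
    the absolute value of \<open>\<tau>\<close> turns a large update into a small ball
    event.\<close>
  have event: "\<bar>column_functional p t \<bullet> X2\<bar> < c / (x * d) * H t X2"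
    if t: "norm t = 1" "\<And>i. \<not> i < k \<Longrightarrow> t $ i = 0"
      and orth: "\<And>j. j < k \<Longrightarrow> j \<noteq> p \<Longrightarrow> (\<Sum>i<k. t $ i * X1 $ i $ j) = 0"
      and in_E: "mix ?R A (?\<Phi> (mix ?Q X1 X2)) \<in> E" for t X1 X2
  proof -
    define Y where "Y = mix ?Q X1 X2"
    define Z where "Z = mix ?R A (?\<Phi> Y)"
    define r where "r = (\<Sum>i<k. t $ i *\<^sub>R Y $ i)"
    define \<tau> where "\<tau> = column_functional p t \<bullet> X2"
    have \<tau>: "\<tau> = (\<Sum>i<k. t $ i * X2 $ i $ p)"
      unfolding \<tau>_def inner_column_functional by (rule sum_lessThan_supp[symmetric, OF t(2)])
    have r: "r $ j = (\<Sum>i<k. t $ i * Y $ i $ j)" for j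
      by (simp add: r_def)
    have r_less: "r $ j = (\<tau> *\<^sub>R axis p 1) $ j" if "j < k" for j
      using that orth[of j] that[THEN not_le[THEN iffD2]] by (auto simp: r Y_def mix_cells \<tau> axis_def)
    have r_ge: "r $ j = (\<Sum>i<k. t $ i * X2 $ i $ j)" if "k \<le> j" for j
      using that by (simp add: r Y_def mix_cells)
    have refl: "reflection v r = r - \<tau> *\<^sub>R axis p 1 + \<tau> *\<^sub>R a1"
      unfolding v_def using a1 r_less v_supp v_def by (intro reflection_axis_shift) blast+
    have tZ: "(\<Sum>i<k. t $ i * Z $ i $ j) = reflection v r $ j" for j
    proof -
      have "(\<Sum>i<k. t $ i * Z $ i $ j) = (\<Sum>i<k. t $ i * ?\<Phi> Y $ i $ j)"
        by (intro sum.cong) (auto simp: Z_def mix_cells)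
      then show ?thesis
        by (simp add: reflect_rows_column_sum[OF t(2)] r_def)
    qed
    have lt: "(\<Sum>i<k. t $ i * Z $ i $ j) = \<tau> * A $ k $ j / c" if "j < k" for j
      unfolding tZ refl using that r_less[OF that] by (simp add: a1_supp)
    have ge: "(\<Sum>i<k. t $ i * Z $ i $ j) = (\<Sum>i<k. t $ i * X2 $ i $ j)" if "k \<le> j" for j
      unfolding tZ refl using that ok r_ge[OF that] by (auto simp: a1_supp axis_def)
    have Zk: "Z $ k $ j = A $ k $ j" for j
      by (simp add: Z_def mix_cells)
    have det: "det (leading_block k Z) \<noteq> 0" and less: "x * d < update_sum k Z"
      using in_E by (auto simp: E_def Z_def Y_def)
    have "\<And>j. j < k \<Longrightarrow> c * (\<Sum>i<k. t $ i * Z $ i $ j) = \<tau> * Z $ k $ j"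
      using lt c by (simp add: Zk)
    note * = update_sum_eq[OF det t c this]
    have "\<bar>\<tau>\<bar> * (x * d) < \<bar>\<tau>\<bar> * update_sum k Z"
      using less *(1) by simp
    also have "\<bar>\<tau>\<bar> * update_sum k Z = c * (\<Sum>j\<in>{k..}. \<bar>\<Sum>i<k. t $ i * Z $ i $ j\<bar>)"
      by (rule *(2))
    also have "\<dots> = c * (\<Sum>j\<in>{k..}. \<bar>\<Sum>i<k. t $ i * X2 $ i $ j\<bar>)"
      using ge by simp
    also have "\<dots> = c * H t X2"
    proof -
      have "(\<Sum>i<k. t $ i * X2 $ i $ j) = (\<Sum>i\<in>UNIV. t $ i * X2 $ i $ j)" for j
        using t(2) by (rule sum_lessThan_supp)
      then show ?thesis
        by (simp add: H_def)
    qed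
    finally show ?thesis
      using x d by (simp add: \<tau>_def field_simps)
  qed

  have inner: "(\<integral>\<^sup>+X2. indicator E (mix ?R A (?\<Phi> (mix ?Q X1 X2))) \<partial>gauss (?\<Phi> \<mu>) \<sigma>)
      \<le> ennreal (sqrt (2 / pi) / \<sigma> * (c / (x * d)) * b)" for X1
  proof -
    \<comment> \<open>The bound to be reached does not depend on \<open>t\<close>, so
      \<open>t\<close> may be chosen separately for each frozen \<open>X1\<close>.\<close>
    obtain t where t: "norm t = 1" "\<And>i. \<not> i < k \<Longrightarrow> t $ i = 0"
      and orth: "\<And>j. j < k \<Longrightarrow> j \<noteq> p \<Longrightarrow> (\<Sum>i<k. t $ i * X1 $ i $ j) = 0"
      using exists_unit_annihilator[OF ok, of X1] by blast
    let ?W = "{X2. \<bar>column_functional p t \<bullet> X2\<bar> < c / (x * d) * H t X2}"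
    have "(\<integral>\<^sup>+X2. indicator E (mix ?R A (?\<Phi> (mix ?Q X1 X2))) \<partial>gauss (?\<Phi> \<mu>) \<sigma>)
        \<le> (\<integral>\<^sup>+X2. indicator ?W X2 \<partial>gauss (?\<Phi> \<mu>) \<sigma>)"
      using event[OF t orth] by (intro nn_integral_mono) (auto simp: indicator_def)
    also have "\<dots> = emeasure (gauss (?\<Phi> \<mu>) \<sigma>) ?W"
      by (rule nn_integral_indicator) measurable
    also have "\<dots> \<le> (\<integral>\<^sup>+X2. ennreal (sqrt (2 / pi) / \<sigma> * (c / (x * d) * H t X2)) \<partial>gauss (?\<Phi> \<mu>) \<sigma>)"
    proof (rule emeasure_gauss_inner_less[OF \<sigma>, where S="?S"])
      show "column_functional p t \<bullet> b = 0" if "b \<in> Basis" "b \<notin> ?S" for b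
        using that by (auto elim!: Basis_matrixE simp: inner_axis_axis column_functional_def)
      show "c / (x * d) * H t (mix ?S X Y) = c / (x * d) * H t X" for X Y
      proof -
        have "mix ?S X Y $ i $ j = X $ i $ j" if "j \<in> {k..}" for i j
          using that ok by (auto simp: mix_cells)
        then show ?thesis
          by (simp add: H_def)
      qed
      show "0 \<le> c / (x * d) * H t X" for X
        using c x d by (auto simp: H_def intro!: mult_nonneg_nonneg sum_nonneg)
    qed (auto simp: norm_column_functional t)
    also have "\<dots> = ennreal (sqrt (2 / pi) / \<sigma> * (c / (x * d))) * (\<integral>\<^sup>+X2. ennreal (H t X2) \<partial>gauss (?\<Phi> \<mu>) \<sigma>)"
    proof (subst nn_integral_cmult[symmetric])
      show "(\<integral>\<^sup>+X2. ennreal (sqrt (2 / pi) / \<sigma> * (c / (x * d) * H t X2)) \<partial>gauss (?\<Phi> \<mu>) \<sigma>)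
        = (\<integral>\<^sup>+X2. ennreal (sqrt (2 / pi) / \<sigma> * (c / (x * d))) * ennreal (H t X2) \<partial>gauss (?\<Phi> \<mu>) \<sigma>)"
        using \<sigma> c x d by (intro nn_integral_cong) (simp add: H_def sum_nonneg mult.assoc flip: ennreal_mult)
    qed measurable
    also have "\<dots> \<le> ennreal (sqrt (2 / pi) / \<sigma> * (c / (x * d))) * ennreal b"
    proof (intro mult_left_mono)
      \<comment> \<open>Since \<open>v\<close> vanishes from \<open>k\<close> on, the rotated mean
        has the original columns there, and the norm bound still applies.\<close>
      have "?\<Phi> \<mu> $ i $ j = \<mu> $ i $ j" if "k \<le> j" for i j
        using that v_supp[of j] by (simp add: reflect_rows_def reflection_def)
      then have "(\<Sum>j\<in>{k..}. (\<Sum>i\<in>UNIV. t $ i * ?\<Phi> \<mu> $ i $ j)\<^sup>2) \<le> 1"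
        using mean[OF t(1)] by simp
      then show "(\<integral>\<^sup>+X2. ennreal (H t X2) \<partial>gauss (?\<Phi> \<mu>) \<sigma>) \<le> ennreal b"
        unfolding H_def b_def using \<sigma> t(1) by (intro nn_integral_gauss_column_sum) auto
    qed simp
    also have "\<dots> = ennreal (sqrt (2 / pi) / \<sigma> * (c / (x * d)) * b)"
      using \<sigma> c x d by (intro ennreal_mult[symmetric]) (auto simp: b_def)
    finally show ?thesis .
  qed

  interpret prob_space "gauss (?\<Phi> \<mu>) \<sigma>"
    using \<sigma> by (rule prob_space_gauss)
  have "(\<integral>\<^sup>+X. indicator E (mix ?R A X) \<partial>gauss \<mu> \<sigma>)
      = (\<integral>\<^sup>+X. indicator E (mix ?R A X) \<partial>gauss (?\<Phi> (?\<Phi> \<mu>)) \<sigma>)"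
    \<comment> \<open>Writing the mean as an image under the involution allows the isometry lemma to
      be read backwards.\<close>
    by (simp add: reflect_rows_reflect_rows)
  also have "\<dots> = (\<integral>\<^sup>+X. indicator E (mix ?R A (?\<Phi> X)) \<partial>gauss (?\<Phi> \<mu>) \<sigma>)"
    by (rule nn_integral_gauss_isometry[symmetric]) (auto simp: linear_reflect_rows norm_reflect_rows)
  also have "\<dots> = (\<integral>\<^sup>+X1. \<integral>\<^sup>+X2. indicator E (mix ?R A (?\<Phi> (mix ?Q X1 X2))) \<partial>gauss (?\<Phi> \<mu>) \<sigma> \<partial>gauss (?\<Phi> \<mu>) \<sigma>)"
    using \<sigma> by (rule nn_integral_mix_gauss) measurable
  also have "\<dots> \<le> (\<integral>\<^sup>+X1. ennreal (sqrt (2 / pi) / \<sigma> * (c / (x * d)) * b) \<partial>gauss (?\<Phi> \<mu>) \<sigma>)"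
    by (intro nn_integral_mono inner)
  also have "\<dots> = ennreal (sqrt (2 / pi) / \<sigma> * (c / (x * d)) * b)"
    using emeasure_space_1 by simp
  also have "sqrt (2 / pi) / \<sigma> * (c / (x * d)) * b = sqrt (2 / pi) / (\<sigma> * x) * b * c / d"
    by (simp add: mult_ac)
  finally show ?thesis
    by (simp add: b_def c_def)
qed

lemma emeasure_update_sum_le:
  fixes \<mu> :: "real^'n::{finite,linorder}^'n::{finite,linorder}" and k l :: 'n
  assumes \<sigma>: "\<sigma> > 0" and x: "x > 0" and "p < k" "k \<le> l"
    and mean: "\<And>t. norm t = 1 \<Longrightarrow> (\<Sum>j\<in>{k..}. (\<Sum>i\<in>UNIV. t $ i * \<mu> $ i $ j)\<^sup>2) \<le> 1"
  shows "emeasure (gauss \<mu> \<sigma>) {A. det (leading_block k A) \<noteq> 0 \<and> x * (\<Sum>j\<in>UNIV. \<bar>A $ l $ j\<bar>) < update_sum k A}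
    \<le> ennreal (sqrt (2 / pi) / (\<sigma> * x) * sqrt (real (card {k..}) * (1 + real (card {k..}) * \<sigma>\<^sup>2)))
      * (\<integral>\<^sup>+A. ennreal (norm (leading_row k A)) * inverse (ennreal (\<Sum>j\<in>UNIV. \<bar>A $ l $ j\<bar>)) \<partial>gauss \<mu> \<sigma>)"
    (is "emeasure _ ?E \<le> ennreal ?C * _")
proof -
  let ?D = "\<lambda>A::real^'n::{finite,linorder}^'n::{finite,linorder}. \<Sum>j\<in>UNIV. \<bar>A $ l $ j\<bar>"
  let ?R = "cells (\<lambda>i j. i < k) :: (real^'n::{finite,linorder}^'n::{finite,linorder}) set"
  have C: "?C > 0"
  proof -
    have "card {k..} > 0"
      by (simp add: card_gt_0_iff)
    then show ?thesis
      using \<sigma> x by (auto intro!: mult_pos_pos divide_pos_pos add_pos_nonneg)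
  qed
  have [measurable]: "(\<lambda>A. norm (leading_row k A)) \<in> borel_measurable borel"
    unfolding norm_vec_def leading_row_def L2_set_def by simp
  have E [measurable]: "?E \<in> sets borel"
    by measurable
  have "emeasure (gauss \<mu> \<sigma>) ?E = (\<integral>\<^sup>+A. indicator ?E A \<partial>gauss \<mu> \<sigma>)"
    by (rule nn_integral_indicator[symmetric]) measurable
  also have "\<dots> = (\<integral>\<^sup>+A. \<integral>\<^sup>+X. indicator ?E (mix ?R A X) \<partial>gauss \<mu> \<sigma> \<partial>gauss \<mu> \<sigma>)"
    using \<sigma> by (rule nn_integral_mix_gauss) measurable
  also have "\<dots> \<le> (\<integral>\<^sup>+A. ennreal ?C * (ennreal (norm (leading_row k A)) * inverse (ennreal (?D A))) \<partial>gauss \<mu> \<sigma>)"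
  proof (rule nn_integral_mono)
    fix A :: "real^'n::{finite,linorder}^'n::{finite,linorder}"
    have row: "leading_row k (mix ?R A X) = leading_row k A" and D: "?D (mix ?R A X) = ?D A" for X
      using \<open>k \<le> l\<close>[THEN not_less[THEN iffD2]] by (simp_all add: leading_row_def mix_cells vec_eq_iff)
    have "?D A \<ge> 0"
      by (simp add: sum_nonneg)
    show "(\<integral>\<^sup>+X. indicator ?E (mix ?R A X) \<partial>gauss \<mu> \<sigma>)
      \<le> ennreal ?C * (ennreal (norm (leading_row k A)) * inverse (ennreal (?D A)))"
    proof (cases "leading_row k A = 0")
      case True
      have "mix ?R A X \<notin> ?E" for X
      proof
        assume *: "mix ?R A X \<in> ?E"
        then have "update_sum k (mix ?R A X) = 0"
          using True by (intro update_sum_zero_row) (auto simp: row)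
        with * D[of X] x \<open>?D A \<ge> 0\<close> show False
          by (auto simp: mult_less_0_iff)
      qed
      then show ?thesis
        by simp
    next
      case False
      show ?thesis
      \<comment> \<open>If row \<open>l\<close> vanishes, the right side is infinite, because the
        other factors are positive.\<close>
      proof (cases "?D A = 0")
        case True
        have "inverse (0::ennreal) = \<top>" "ennreal (norm (leading_row k A)) \<noteq> 0" "ennreal ?C \<noteq> 0"
          using False C by (simp_all only: ennreal_eq_0_iff not_le zero_less_norm_iff ennreal_inverse_zero simp_thms)
        then have "ennreal ?C * (ennreal (norm (leading_row k A)) * inverse (ennreal (?D A))) = \<top>"
          by (simp only: True ennreal_0 ennreal_mult_top if_False ennreal_top_neq_zero simp_thms)
        then show ?thesis
          by simp
      next
        case nz: False
        with \<open>?D A \<ge> 0\<close> have pos: "?D A > 0" by (metis order_less_le)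
        have "(\<integral>\<^sup>+X. indicator ?E (mix ?R A X) \<partial>gauss \<mu> \<sigma>)
            = (\<integral>\<^sup>+X. indicator {Z. det (leading_block k Z) \<noteq> 0 \<and> x * ?D A < update_sum k Z} (mix ?R A X) \<partial>gauss \<mu> \<sigma>)"
          by (intro nn_integral_cong) (simp add: indicator_def D)
        also have "\<dots> \<le> ennreal (?C * norm (leading_row k A) / ?D A)"
          using \<sigma> x \<open>p < k\<close> pos False mean by (rule emeasure_update_sum_fixed)
        also have "\<dots> = ennreal ?C * (ennreal (norm (leading_row k A)) * inverse (ennreal (?D A)))"
          using pos C by (simp add: inverse_ennreal divide_inverse mult.assoc flip: ennreal_mult)
        finally show ?thesis .
      qed
    qed
  qed
  also have "\<dots> = ennreal ?C * (\<integral>\<^sup>+A. ennreal (norm (leading_row k A)) * inverse (ennreal (?D A)) \<partial>gauss \<mu> \<sigma>)"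
    by (rule nn_integral_cmult) measurable
  finally show ?thesis .
qed

section \<open>Law of the perturbation and moments of its rows\<close>

text \<open>Duality: pairing \<open>t v* A\<close> with itself moves \<open>A\<close> to the other
  side, where the operator norm is available.\<close>

lemma norm_vector_matrix_le:
  fixes A :: "real^'n^'m"
  shows "norm (t v* A) \<le> matrix_norm2 A * norm t"
proof (cases "t v* A = 0")
  case False
  let ?z = "t v* A"
  have "(norm ?z)\<^sup>2 = t \<bullet> (A *v ?z)"
    by (simp add: power2_norm_eq_inner dot_lmul_matrix)
  also have "\<dots> \<le> norm t * norm (A *v ?z)"
    by (rule norm_cauchy_schwarz)
  also have "\<dots> \<le> norm t * (matrix_norm2 A * norm ?z)"
    unfolding matrix_norm2_def by (intro mult_left_mono onorm matrix_vector_mul_bounded_linear) simp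
  finally have "norm ?z * norm ?z \<le> (matrix_norm2 A * norm t) * norm ?z"
    by (simp only: power2_eq_square mult_ac)
  then show ?thesis
    using False by (simp only: mult_le_cancel_right zero_less_norm_iff) auto
qed (simp add: matrix_norm2_def onorm_pos_le matrix_vector_mul_bounded_linear)

lemma sum_column_means_le_1:
  fixes \<mu> :: "real^'n^'m"
  assumes "matrix_norm2 \<mu> \<le> 1" "norm t = 1"
  shows "(\<Sum>j\<in>J. (\<Sum>i\<in>UNIV. t $ i * \<mu> $ i $ j)\<^sup>2) \<le> 1"
proof -
  have "(\<Sum>j\<in>J. (\<Sum>i\<in>UNIV. t $ i * \<mu> $ i $ j)\<^sup>2) \<le> (\<Sum>j\<in>UNIV. (\<Sum>i\<in>UNIV. t $ i * \<mu> $ i $ j)\<^sup>2)"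
    by (intro sum_mono2) auto
  also have "\<dots> = (norm (t v* \<mu>))\<^sup>2"
    unfolding power2_norm_eq_inner by (simp add: vector_matrix_mult_def inner_vec_def power2_eq_square mult.commute)
  also have "\<dots> \<le> 1\<^sup>2"
    using norm_vector_matrix_le[of t \<mu>] assms by (intro power_mono) auto
  finally show ?thesis
    by simp
qed

section \<open>The law of the perturbed matrix\<close>

lemma gauss_translate:
  fixes a :: real
  assumes [measurable]: "T \<in> sets borel"
  shows "emeasure (gauss 0 \<sigma>) {y. a + y \<in> T} = emeasure (gauss a \<sigma>) T"
proof -
  have "emeasure (gauss a \<sigma>) T = (\<integral>\<^sup>+y. ennreal (normal_density a \<sigma> y) * indicator T y \<partial>lborel)"
    unfolding gauss_real by (rule emeasure_density) auto
  also have "\<dots> = (\<integral>\<^sup>+y. ennreal (normal_density a \<sigma> y) * indicator T y \<partial>distr lborel borel ((+) a))"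
    by (simp add: lborel_distr_plus)
  also have "\<dots> = (\<integral>\<^sup>+y. ennreal (normal_density a \<sigma> (a + y)) * indicator T (a + y) \<partial>lborel)"
    by (rule nn_integral_distr) measurable
  also have "\<dots> = (\<integral>\<^sup>+y. ennreal (normal_density 0 \<sigma> y) * indicator {y. a + y \<in> T} y \<partial>lborel)"
    by (intro nn_integral_cong) (simp add: normal_density_def indicator_def)
  also have "\<dots> = emeasure (gauss 0 \<sigma>) {y. a + y \<in> T}"
    unfolding gauss_real by (rule emeasure_density[symmetric]) auto
  finally show ?thesis ..
qed

lemma ball_matrix_Basis:
  "(\<forall>b\<in>(Basis :: (real^'m^'n) set). P b) \<longleftrightarrow> (\<forall>i j. P (axis i (axis j 1)))"
proof (intro iffI ballI)
  fix b :: "real^'m^'n"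
  assume "\<forall>i j. P (axis i (axis j 1))" "b \<in> Basis"
  then show "P b"
    by (elim Basis_matrixE) simp
qed (simp add: axis_axis_in_Basis)

text \<open>Independence of the entries is the product formula on cylinders, and
  \<open>gauss_eqI\<close> turns it into an equality of laws.\<close>

lemma distr_gaussian_perturbation:
  fixes Abar :: "real^'n^'m"
  assumes "prob_space M" "\<sigma> > 0" "gaussian_perturbation M Abar \<sigma> A"
  shows "A \<in> borel_measurable M" "distr M borel A = gauss Abar \<sigma>"
proof -
  interpret prob_space M by fact
  obtain G where A: "\<And>\<omega>. \<omega> \<in> space M \<Longrightarrow> A \<omega> = Abar + G \<omega>"
    and indep: "indep_vars (\<lambda>_. borel) (\<lambda>(i, j) \<omega>. G \<omega> $ i $ j) UNIV"
    and G: "\<And>i j. distributed M lborel (\<lambda>\<omega>. G \<omega> $ i $ j) (normal_density 0 \<sigma>)"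
    using assms(3) unfolding gaussian_perturbation_def by blast
  have [measurable]: "(\<lambda>\<omega>. G \<omega> $ i $ j) \<in> borel_measurable M" for i j
    using distributed_measurable[OF G[of i j]] by simp
  show measurable_A [measurable]: "A \<in> borel_measurable M"
  proof (subst borel_measurable_euclidean_space, intro ballI)
    fix b :: "real^'n^'m" assume "b \<in> Basis"
    then obtain i j where b: "b = axis i (axis j 1)"
      by (rule Basis_matrixE)
    have "(\<lambda>\<omega>. Abar $ i $ j + G \<omega> $ i $ j) \<in> borel_measurable M"
      by measurable
    then show "(\<lambda>\<omega>. A \<omega> \<bullet> b) \<in> borel_measurable M"
      by (rule measurable_cong[THEN iffD1, rotated]) (simp add: b inner_axis_axis A)
  qed
  show "distr M borel A = gauss Abar \<sigma>"
  proof (rule gauss_eqI)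
    fix T :: "real^'n^'m \<Rightarrow> real set" assume T [measurable]: "\<And>b. T b \<in> sets borel"
    \<comment> \<open>The shift by \<open>Abar\<close> is moved into the sets, so that the
      independence of the entries of \<open>G\<close> applies directly.\<close>
    define T' where "T' = (\<lambda>(i, j). {y. Abar $ i $ j + y \<in> T (axis i (axis j 1))})"
    have T' [measurable]: "T' ij \<in> sets borel" for ij
      unfolding T'_def by (cases ij) simp
    define X where "X = (\<lambda>(i, j) \<omega>. G \<omega> $ i $ j)"
    have one: "prob (X ij -` T' ij \<inter> space M) = measure (gauss (Abar $ fst ij $ snd ij) \<sigma>) (T (axis (fst ij) (axis (snd ij) 1)))" for ij
    proof -
      have "emeasure M ((\<lambda>\<omega>. G \<omega> $ fst ij $ snd ij) -` T' ij \<inter> space M)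
          = emeasure (distr M lborel (\<lambda>\<omega>. G \<omega> $ fst ij $ snd ij)) (T' ij)"
        by (rule emeasure_distr[symmetric]) auto
      also have "distr M lborel (\<lambda>\<omega>. G \<omega> $ fst ij $ snd ij) = gauss 0 \<sigma>"
        unfolding gauss_real using G by (simp add: distributed_distr_eq_density)
      also have "emeasure (gauss 0 \<sigma>) (T' ij) = emeasure (gauss (Abar $ fst ij $ snd ij) \<sigma>) (T (axis (fst ij) (axis (snd ij) 1)))"
        by (simp add: T'_def case_prod_beta gauss_translate)
      finally show ?thesis
        by (simp add: measure_def X_def case_prod_beta)
    qed
    have "{x. \<forall>b\<in>Basis. x \<bullet> b \<in> T b} \<in> sets borel"
      by (rule cylinder_sets) (rule T)
    then have "emeasure (distr M borel A) {x. \<forall>b\<in>Basis. x \<bullet> b \<in> T b}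
        = emeasure M (A -` {x. \<forall>b\<in>Basis. x \<bullet> b \<in> T b} \<inter> space M)"
      by (simp add: emeasure_distr)
    also have "A -` {x. \<forall>b\<in>Basis. x \<bullet> b \<in> T b} \<inter> space M = (\<Inter>ij\<in>UNIV. X ij -` T' ij \<inter> space M)"
    proof -
      have "(\<forall>b\<in>Basis. A \<omega> \<bullet> b \<in> T b) \<longleftrightarrow> (\<forall>ij. X ij \<omega> \<in> T' ij)" if "\<omega> \<in> space M" for \<omega>
        by (simp add: ball_matrix_Basis inner_axis_axis T'_def X_def A[OF that])
      then have "\<omega> \<in> A -` {x. \<forall>b\<in>Basis. x \<bullet> b \<in> T b} \<inter> space M \<longleftrightarrow> \<omega> \<in> (\<Inter>ij\<in>UNIV. X ij -` T' ij \<inter> space M)" for \<omega>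
        by (cases "\<omega> \<in> space M") simp_all
      then show ?thesis
        by (rule set_eqI)
    qed
    also have "emeasure M \<dots> = ennreal (prob (\<Inter>ij\<in>UNIV. X ij -` T' ij \<inter> space M))"
      by (rule emeasure_eq_measure)
    also have "prob (\<Inter>ij\<in>UNIV. X ij -` T' ij \<inter> space M) = (\<Prod>ij\<in>UNIV. prob (X ij -` T' ij \<inter> space M))"
      using indep unfolding X_def by (rule indep_varsD_finite) auto
    also have "ennreal \<dots> = (\<Prod>ij\<in>UNIV. emeasure (gauss (Abar $ fst ij $ snd ij) \<sigma>) (T (axis (fst ij) (axis (snd ij) 1))))"
    proof (subst prod_ennreal[symmetric])
      show "(\<Prod>ij\<in>UNIV. ennreal (prob (X ij -` T' ij \<inter> space M)))
        = (\<Prod>ij\<in>UNIV. emeasure (gauss (Abar $ fst ij $ snd ij) \<sigma>) (T (axis (fst ij) (axis (snd ij) 1))))"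
      proof (rule prod.cong)
        fix ij :: "'m \<times> 'n"
        interpret N: prob_space "gauss (Abar $ fst ij $ snd ij) \<sigma>"
          using \<open>\<sigma> > 0\<close> by (rule prob_space_gauss)
        show "ennreal (prob (X ij -` T' ij \<inter> space M)) = emeasure (gauss (Abar $ fst ij $ snd ij) \<sigma>) (T (axis (fst ij) (axis (snd ij) 1)))"
          unfolding one by (simp add: N.emeasure_eq_measure)
      qed simp
    qed simp
    also have "\<dots> = (\<Prod>b\<in>Basis. emeasure (gauss (Abar \<bullet> b) \<sigma>) (T b))"
      by (subst prod.reindex_bij_betw[OF bij_betw_matrix_Basis, symmetric])
        (simp add: case_prod_beta inner_axis_axis)
    finally show "emeasure (distr M borel A) {x. \<forall>b\<in>Basis. x \<bullet> b \<in> T b} = (\<Prod>b\<in>Basis. emeasure (gauss (Abar \<bullet> b) \<sigma>) (T b))" .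
  qed (use assms in auto)
qed

section \<open>The ratio of a leading row to the l1 norm of the last row\<close>

lemma borel_measurable_norm_leading_row [measurable]:
  "(\<lambda>A. norm (leading_row k A)) \<in> borel_measurable borel"
  unfolding norm_vec_def leading_row_def L2_set_def by simp

lemma nn_integral_leading_row_ratio_same:
  fixes \<mu> :: "real^'n::{finite,linorder}^'n::{finite,linorder}"
  assumes "\<sigma> > 0"
  shows "(\<integral>\<^sup>+A. ennreal (norm (leading_row k A)) * inverse (ennreal (\<Sum>j\<in>UNIV. \<bar>A $ k $ j\<bar>)) \<partial>gauss \<mu> \<sigma>) \<le> 1"
proof -
  interpret prob_space "gauss \<mu> \<sigma>"
    using assms by (rule prob_space_gauss)
  have "ennreal (norm (leading_row k A)) * inverse (ennreal (\<Sum>j\<in>UNIV. \<bar>A $ k $ j\<bar>)) \<le> 1" for A :: "real^'n::{finite,linorder}^'n::{finite,linorder}"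
  proof -
    let ?D = "\<Sum>j\<in>UNIV. \<bar>A $ k $ j\<bar>"
    have "norm (leading_row k A) \<le> (\<Sum>j\<in>UNIV. \<bar>leading_row k A $ j\<bar>)"
      by (rule norm_le_l1_cart)
    also have "\<dots> \<le> ?D"
      by (intro sum_mono) (simp add: leading_row_def)
    finally have le: "norm (leading_row k A) \<le> ?D" .
    show ?thesis
    proof (cases "?D = 0")
      \<comment> \<open>Here the leading row vanishes too, and zero times infinity is zero.\<close>
      case True
      then show ?thesis using le by simp
    next
      case False
      then have "?D > 0" using le by (smt (verit) norm_ge_zero)
      then show ?thesis
        using le by (simp add: inverse_ennreal divide_inverse[symmetric] flip: ennreal_mult)
    qed
  qed
  then have "(\<integral>\<^sup>+A. ennreal (norm (leading_row k A)) * inverse (ennreal (\<Sum>j\<in>UNIV. \<bar>A $ k $ j\<bar>)) \<partial>gauss \<mu> \<sigma>)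
      \<le> (\<integral>\<^sup>+A. 1 \<partial>gauss \<mu> \<sigma>)"
    by (intro nn_integral_mono)
  then show ?thesis
    using emeasure_space_1 by simp
qed

text \<open>Only the second moment is computed; AM-GM at the scale \<open>s\<close>, the bound on
  the root mean square, turns it into a first moment.\<close>

lemma nn_integral_norm_leading_row:
  fixes \<mu> :: "real^'n::{finite,linorder}^'n::{finite,linorder}"
  assumes "\<sigma> > 0" and mean: "(\<Sum>j\<in>UNIV. (\<mu> $ k $ j)\<^sup>2) \<le> 1"
  shows "(\<integral>\<^sup>+A. ennreal (norm (leading_row k A)) \<partial>gauss \<mu> \<sigma>) \<le> ennreal (sqrt (1 + real (card {..<k}) * \<sigma>\<^sup>2))"
proof -
  interpret prob_space "gauss \<mu> \<sigma>"
    using assms(1) by (rule prob_space_gauss)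
  define s where "s = sqrt (1 + real (card {..<k}) * \<sigma>\<^sup>2)"
  have "s > 0" and s2: "s * s = 1 + real (card {..<k}) * \<sigma>\<^sup>2"
    by (auto simp: s_def add_pos_nonneg)
  have sq: "(\<integral>\<^sup>+A. ennreal ((A $ k $ j)\<^sup>2) \<partial>gauss \<mu> \<sigma>) = ennreal ((\<mu> $ k $ j)\<^sup>2 + \<sigma>\<^sup>2)" for j
    using nn_integral_gauss_inner_power2[of "axis k (axis j 1)" \<sigma> \<mu>] assms(1)
    by (simp add: inner_axis_axis inner_commute[of "axis k (axis j 1)"] norm_axis_1)
  have norm2: "(norm (leading_row k A))\<^sup>2 = (\<Sum>j<k. (A $ k $ j)\<^sup>2)" for A :: "real^'n::{finite,linorder}^'n::{finite,linorder}"
  proof -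
    have "(norm (leading_row k A))\<^sup>2 = (\<Sum>j\<in>UNIV. leading_row k A $ j * leading_row k A $ j)"
      by (simp only: power2_norm_eq_inner inner_vec_def inner_real_def)
    also have "\<dots> = (\<Sum>j<k. leading_row k A $ j * leading_row k A $ j)"
      by (intro sum.mono_neutral_right) (auto simp: leading_row_def)
    also have "\<dots> = (\<Sum>j<k. (A $ k $ j)\<^sup>2)"
      by (intro sum.cong) (auto simp: leading_row_def power2_eq_square)
    finally show ?thesis .
  qed
  have "(\<integral>\<^sup>+A. ennreal (norm (leading_row k A)) \<partial>gauss \<mu> \<sigma>)
      \<le> (\<integral>\<^sup>+A. ennreal (s / 2) + ennreal (1 / (2 * s)) * (\<Sum>j<k. ennreal ((A $ k $ j)\<^sup>2)) \<partial>gauss \<mu> \<sigma>)"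
  proof (rule nn_integral_mono)
    fix A :: "real^'n::{finite,linorder}^'n::{finite,linorder}"
    have "ennreal (norm (leading_row k A)) \<le> ennreal (s / 2 + 1 / (2 * s) * (\<Sum>j<k. (A $ k $ j)\<^sup>2))"
      using abs_le_AM_GM[OF \<open>s > 0\<close>, of "norm (leading_row k A)"] by (intro ennreal_leI) (simp add: norm2)
    also have "\<dots> = ennreal (s / 2) + ennreal (1 / (2 * s) * (\<Sum>j<k. (A $ k $ j)\<^sup>2))"
      using \<open>s > 0\<close> by (intro ennreal_plus) (auto intro!: sum_nonneg divide_nonneg_pos)
    also have "ennreal (1 / (2 * s) * (\<Sum>j<k. (A $ k $ j)\<^sup>2)) = ennreal (1 / (2 * s)) * (\<Sum>j<k. ennreal ((A $ k $ j)\<^sup>2))"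
      using \<open>s > 0\<close> by (subst sum_ennreal, simp) (rule ennreal_mult, auto intro!: sum_nonneg)
    finally show "ennreal (norm (leading_row k A)) \<le> ennreal (s / 2) + ennreal (1 / (2 * s)) * (\<Sum>j<k. ennreal ((A $ k $ j)\<^sup>2))" .
  qed
  also have "\<dots> = ennreal (s / 2) + ennreal (1 / (2 * s)) * (\<Sum>j<k. ennreal ((\<mu> $ k $ j)\<^sup>2 + \<sigma>\<^sup>2))"
    using emeasure_space_1 by (simp add: nn_integral_add nn_integral_cmult nn_integral_sum sq del: sum_ennreal ennreal_plus)
  also have "\<dots> = ennreal (s / 2 + 1 / (2 * s) * (\<Sum>j<k. (\<mu> $ k $ j)\<^sup>2 + \<sigma>\<^sup>2))"
  proof -
    have "0 \<le> (\<Sum>j<k. (\<mu> $ k $ j)\<^sup>2 + \<sigma>\<^sup>2)"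
      by (intro sum_nonneg) simp
    then show ?thesis
      using \<open>s > 0\<close> by (subst sum_ennreal) (auto simp flip: ennreal_plus ennreal_mult)
  qed
  also have "\<dots> \<le> ennreal s"
  proof (rule ennreal_leI)
    have "(\<Sum>j<k. (\<mu> $ k $ j)\<^sup>2) \<le> (\<Sum>j\<in>UNIV. (\<mu> $ k $ j)\<^sup>2)"
      by (intro sum_mono2) auto
    then have "(\<Sum>j<k. (\<mu> $ k $ j)\<^sup>2 + \<sigma>\<^sup>2) \<le> s * s"
      using mean by (simp add: sum.distrib s2)
    then have "s / 2 + 1 / (2 * s) * (\<Sum>j<k. (\<mu> $ k $ j)\<^sup>2 + \<sigma>\<^sup>2) \<le> s / 2 + 1 / (2 * s) * (s * s)"
      using \<open>s > 0\<close> by (intro add_left_mono mult_left_mono) auto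
    also have "\<dots> = s"
      using \<open>s > 0\<close> by simp
    finally show "s / 2 + 1 / (2 * s) * (\<Sum>j<k. (\<mu> $ k $ j)\<^sup>2 + \<sigma>\<^sup>2) \<le> s" .
  qed
  finally show ?thesis
    by (simp add: s_def)
qed

text \<open>Resampling row \<open>l\<close> alone splits the integral into a product, since row
  \<open>k\<close> does not see the new copy.\<close>

lemma nn_integral_leading_row_ratio_other:
  fixes \<mu> :: "real^'n::{finite,linorder}^'n::{finite,linorder}"
  assumes "\<sigma> > 0" "k \<noteq> l" "CARD('n) \<ge> 2" and mean: "(\<Sum>j\<in>UNIV. (\<mu> $ k $ j)\<^sup>2) \<le> 1"
  shows "(\<integral>\<^sup>+A. ennreal (norm (leading_row k A)) * inverse (ennreal (\<Sum>j\<in>UNIV. \<bar>A $ l $ j\<bar>)) \<partial>gauss \<mu> \<sigma>)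
    \<le> ennreal (sqrt (1 + real (card {..<k}) * \<sigma>\<^sup>2) * (16 / (9 * \<sigma> * (real CARD('n) - 1))))"
proof -
  let ?S = "cells (\<lambda>i j. i = l) :: (real^'n::{finite,linorder}^'n::{finite,linorder}) set"
  let ?D = "\<lambda>A::real^'n::{finite,linorder}^'n::{finite,linorder}. \<Sum>j\<in>UNIV. \<bar>A $ l $ j\<bar>"
  have S: "?S = (\<lambda>j. axis l (axis j 1)) ` UNIV" and inj: "inj (\<lambda>j. axis l (axis j (1::real)) :: real^'n::{finite,linorder}^'n::{finite,linorder})"
    by (auto simp: cells_def inj_on_def axis_eq_axis)
  have card: "card ?S = CARD('n)"
    unfolding S using inj by (rule card_image)
  have D: "?D A = (\<Sum>b\<in>?S. \<bar>A \<bullet> b\<bar>)" for A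
    unfolding S by (simp add: sum.reindex inj inner_axis_axis)
  have D_bound: "(\<integral>\<^sup>+A. inverse (ennreal (?D A)) \<partial>gauss \<mu> \<sigma>) \<le> ennreal (16 / (9 * \<sigma> * (real CARD('n) - 1)))"
    unfolding D card[symmetric] using assms(1,3)
    by (intro nn_integral_gauss_inverse_sum_abs cells_subset_Basis) (simp_all add: card)
  have "(\<integral>\<^sup>+A. ennreal (norm (leading_row k A)) * inverse (ennreal (?D A)) \<partial>gauss \<mu> \<sigma>)
      = (\<integral>\<^sup>+A. \<integral>\<^sup>+B. ennreal (norm (leading_row k (mix ?S A B))) * inverse (ennreal (?D (mix ?S A B))) \<partial>gauss \<mu> \<sigma> \<partial>gauss \<mu> \<sigma>)"
    using assms(1) by (rule nn_integral_mix_gauss) measurable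
  also have "\<dots> = (\<integral>\<^sup>+A. \<integral>\<^sup>+B. ennreal (norm (leading_row k A)) * inverse (ennreal (?D B)) \<partial>gauss \<mu> \<sigma> \<partial>gauss \<mu> \<sigma>)"
  proof -
    have "leading_row k (mix ?S A B) = leading_row k A" for A B
      using assms(2) by (simp add: mix_cells leading_row_def vec_eq_iff)
    moreover have "?D (mix ?S A B) = ?D B" for A B
      by (simp add: mix_cells)
    ultimately show ?thesis
      by simp
  qed
  also have "\<dots> = (\<integral>\<^sup>+A. ennreal (norm (leading_row k A)) \<partial>gauss \<mu> \<sigma>) * (\<integral>\<^sup>+B. inverse (ennreal (?D B)) \<partial>gauss \<mu> \<sigma>)"
    by (simp add: nn_integral_cmult nn_integral_multc)
  also have "\<dots> \<le> ennreal (sqrt (1 + real (card {..<k}) * \<sigma>\<^sup>2)) * ennreal (16 / (9 * \<sigma> * (real CARD('n) - 1)))"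
    by (intro mult_mono nn_integral_norm_leading_row assms D_bound) auto
  also have "\<dots> = ennreal (sqrt (1 + real (card {..<k}) * \<sigma>\<^sup>2) * (16 / (9 * \<sigma> * (real CARD('n) - 1))))"
    using assms by (intro ennreal_mult[symmetric]) auto
  finally show ?thesis .
qed

text \<open>The shape is dictated by the application: \<open>n - 1\<close> cancels against the bound
  for the mean of 1 / D. With \<open>u\<close> and \<open>w\<close> the roots of \<open>n\<close>
  and \<open>n + 1\<close>, the induction step amounts to \<open>1 \<le> 3 * u * (w - u)\<close>,
  which follows from \<open>(w - u) * (w + u) = 1\<close> and \<open>w \<le> 2 * u\<close>.\<close>

lemma sum_sqrt_le: "(\<Sum>m\<in>{2..<n}. sqrt (real m)) \<le> 3 / 4 * (real n - 1) * sqrt (real n)" if "n \<ge> 1"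
  using that
proof (induction n rule: dec_induct)
  case (step n)
  define u where "u = sqrt (real n)"
  define w where "w = sqrt (real n + 1)"
  have u: "u \<ge> 1" "u * u = real n" and w: "w \<ge> u" "w * w = real n + 1"
    using step by (auto simp: u_def w_def)
  \<comment> \<open>At \<open>n = 1\<close> both ranges are empty, so there this is only an
    inequality.\<close>
  have "sum (\<lambda>m. sqrt (real m)) {2..<Suc n} \<le> sum (\<lambda>m. sqrt (real m)) {2..<n} + u"
    by (cases "2 \<le> n") (auto simp: u_def)
  also have "\<dots> \<le> 3 / 4 * (u * u - 1) * u + u"
    using step.IH u by (simp add: u_def)
  also have "\<dots> \<le> 3 / 4 * (u * u) * w"
  proof -
    have "(w - u) * (w + u) = 1"
      using u w by (simp add: algebra_simps)
    moreover have "w \<le> 2 * u"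
    proof -
      have "w * w \<le> (2 * u) * (2 * u)"
        using u w step.hyps by simp
      then show ?thesis
        using u(1) power2_le_imp_le[of w "2 * u"] by (simp add: power2_eq_square)
    qed
    ultimately have "1 \<le> (w - u) * (3 * u)"
      using w(1) mult_left_mono[of "w + u" "3 * u" "w - u"] by simp
    then have "u * 1 \<le> u * ((w - u) * (3 * u))"
      using u(1) by (intro mult_left_mono) auto
    moreover have "u * ((w - u) * (3 * u)) = 3 * (u * u * w) - 3 * (u * u * u)"
      by algebra
    moreover have "3 / 4 * (u * u - 1) * u + u = 3 / 4 * (u * u * u) + u / 4"
      by (simp add: field_simps)
    ultimately show ?thesis
      by simp
  qed
  finally show ?case
    using u by (simp add: w_def add.commute)
qed simp

section \<open>Summation over the rows\<close>

lemma card_atLeast_lessThan: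
  fixes k :: "'n::{finite,linorder}"
  shows "card {k..} + card {..<k} = CARD('n)"
proof -
  have "card {k..} + card {..<k} = card ({k..} \<union> {..<k})"
    by (rule card_Un_disjoint[symmetric]) auto
  also have "{k..} \<union> {..<k} = UNIV"
    by auto
  finally show ?thesis .
qed

text \<open>The number of indices from \<open>k\<close> on strictly decreases in \<open>k\<close>,
  so its values are distinct; dropping the two extreme indices leaves values from 2 to n -
  1.\<close>

lemma sum_sqrt_card_atLeast_le:
  fixes l :: "'n::{finite,linorder}"
  assumes l: "\<And>k. k \<le> l" and p: "\<And>k. p \<le> k"
  shows "(\<Sum>k\<in>UNIV - {l, p}. sqrt (real (card {k..}))) \<le> 3 / 4 * (real CARD('n) - 1) * sqrt (real CARD('n))"
proof -
  let ?m = "\<lambda>k::'n. card {k..}"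
  have less: "?m k < ?m k'" if "k' < k" for k k'
    using that by (intro psubset_card_mono) auto
  have "inj ?m"
    by (rule injI) (metis less neqE nat_neq_iff)
  have range: "?m k \<in> {2..<CARD('n)}" if "k \<in> UNIV - {l, p}" for k
  proof -
    have "l > k" "k > p"
      using that l[of k] p[of k] by auto
    then have "?m l < ?m k" "?m k < ?m p"
      by (simp_all add: less)
    moreover have "?m l > 0"
      by (simp add: card_gt_0_iff)
    moreover have "?m p \<le> CARD('n)"
      by (rule card_mono) auto
    ultimately show ?thesis by simp
  qed
  have "(\<Sum>k\<in>UNIV - {l, p}. sqrt (real (?m k))) = (\<Sum>m\<in>?m ` (UNIV - {l, p}). sqrt (real m))"
    using \<open>inj ?m\<close> by (subst sum.reindex) (auto intro: inj_on_subset)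
  also have "\<dots> \<le> (\<Sum>m\<in>{2..<CARD('n)}. sqrt (real m))"
    using range by (intro sum_mono2 image_subsetI) simp_all
  also have "\<dots> \<le> 3 / 4 * (real CARD('n) - 1) * sqrt (real CARD('n))"
    by (rule sum_sqrt_le) (simp add: Suc_leI)
  finally show ?thesis .
qed

theorem theorem4p3:
  fixes M :: "'w measure"
    and Abar :: "real^'n::{finite,linorder}^'n::{finite,linorder}"
    and A :: "'w \<Rightarrow> real^'n::{finite,linorder}^'n::{finite,linorder}"
    and \<sigma> x :: real
  assumes "prob_space M"
    and "CARD('n) \<ge> 2"
    and "matrix_norm2 Abar \<le> 1"
    and "\<sigma> > 0" and "\<sigma>\<^sup>2 \<le> 1"
    and "gaussian_perturbation M Abar \<sigma> A"
    and "x > 0"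
  shows "{\<omega> \<in> space M. growth_factor (A \<omega>) > 1 + x} \<in> sets M \<and>
    measure M {\<omega> \<in> space M. growth_factor (A \<omega>) > 1 + x} \<le>
      sqrt (2 / pi) * (1 / x) *
        (2 / 3 * real CARD('n) powr (3 / 2) + real CARD('n) / \<sigma>
          + 4 / 3 * (sqrt (real CARD('n)) / \<sigma>\<^sup>2))"
proof
  interpret prob_space M by fact
  have \<sigma>: "\<sigma> > 0" and x: "x > 0" by fact+
  note [measurable] = distr_gaussian_perturbation(1)[OF assms(1,4,6)]
  show meas: "{\<omega> \<in> space M. growth_factor (A \<omega>) > 1 + x} \<in> sets M"
    by measurable
  define n where "n = real CARD('n)"
  have n: "n \<ge> 2"
    using assms(2) by (simp add: n_def)
  define l where "l = Max (UNIV :: 'n set)"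
  define p where "p = Min (UNIV :: 'n set)"
  have l: "k \<le> l" and p: "p \<le> k" for k
    by (simp_all add: l_def p_def)
  define q where "q = sqrt (2 / pi) / x"
  have q: "q > 0"
    using x by (simp add: q_def)
  let ?E = "\<lambda>k. {A. det (leading_block k A) \<noteq> 0 \<and> x * (\<Sum>j\<in>UNIV. \<bar>A $ l $ j\<bar>) < update_sum k A}"
  let ?\<gamma> = "gauss Abar \<sigma>"
  let ?m = "\<lambda>k::'n. real (card {k..})" and ?p = "\<lambda>k::'n. real (card {..<k})"
  let ?K = "(1 + n * \<sigma>\<^sup>2 / 2) * (16 / (9 * \<sigma>\<^sup>2 * (n - 1)))"
  have E [measurable]: "?E k \<in> sets borel" for k
    by measurable
  have mean: "(\<Sum>j\<in>J. (\<Sum>i\<in>UNIV. t $ i * Abar $ i $ j)\<^sup>2) \<le> 1" if "norm t = 1" for t J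
    using assms(3) that by (rule sum_column_means_le_1)
  have mean_row: "(\<Sum>j\<in>UNIV. (Abar $ k $ j)\<^sup>2) \<le> 1" for k
    using mean[of "axis k 1" UNIV, OF norm_axis_1] by (simp add: axis_def if_distrib[of "\<lambda>u. u * _"] cong: if_cong)
  note bound = emeasure_update_sum_le[OF \<sigma> x _ l mean]

  \<comment> \<open>No row precedes the least index, so the update is zero and cannot exceed a
    nonnegative threshold.\<close>
  have first: "emeasure ?\<gamma> (?E p) = 0"
  proof -
    have "{..<p} = {}"
      using leD[OF p] by auto
    then have "?E p = {}"
      using x by (auto simp: update_sum_def not_less sum_nonneg)
    then show ?thesis by (simp only: emeasure_empty)
  qed

  have "p < l"
  proof -
    obtain a b :: 'n where "a \<noteq> b"
      using assms(2) by (metis card_2_iff' card_le_Suc0_iff_eq finite not_less_eq_eq numeral_2_eq_2 UNIV_I)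
    then show ?thesis
      using l[of a] l[of b] p[of a] p[of b] by (metis order.antisym order.trans not_less)
  qed

  \<comment> \<open>Here the columns from \<open>l\<close> on reduce to a single one and the ratio
    of norms is at most 1, so no inverse moment is needed. This row produces the term n /
    sigma.\<close>
  have last: "emeasure ?\<gamma> (?E l) \<le> ennreal (q * (n / \<sigma>))"
  proof -
    have "{l..} = {l}"
      using l by (auto intro: antisym)
    then have "emeasure ?\<gamma> (?E l) \<le> ennreal (sqrt (2 / pi) / (\<sigma> * x) * sqrt (1 + \<sigma>\<^sup>2)) * 1"
      using order_trans[OF bound[OF \<open>p < l\<close>] mult_left_mono[OF nn_integral_leading_row_ratio_same[OF \<sigma>]]] by simp
    also have "\<dots> \<le> ennreal (q * (n / \<sigma>))"
    proof -
      \<comment> \<open>The bound on the variance enters here: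
        \<open>1 + \<sigma>\<^sup>2 \<le> 2\<close>, while \<open>n\<^sup>2\<close> is at least
        4.\<close>
      have "sqrt (1 + \<sigma>\<^sup>2) \<le> n"
        using n assms(5) power_mono[OF n, of 2] by (intro real_le_lsqrt) auto
      then have "q * (sqrt (1 + \<sigma>\<^sup>2) / \<sigma>) \<le> q * (n / \<sigma>)"
        using q \<sigma> by (intro mult_left_mono divide_right_mono) auto
      then show ?thesis
        by (simp add: q_def ennreal_leI mult_ac)
    qed
    finally show ?thesis .
  qed

  have middle: "emeasure ?\<gamma> (?E k) \<le> ennreal (q * ?K * sqrt (?m k))" if "k \<in> UNIV - {l, p}" for k
  proof -
    have k: "p < k" "k \<noteq> l"
      using that p[of k] by auto
    have "emeasure ?\<gamma> (?E k) \<le> ennreal (sqrt (2 / pi) / (\<sigma> * x) * sqrt (?m k * (1 + ?m k * \<sigma>\<^sup>2)))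
        * ennreal (sqrt (1 + ?p k * \<sigma>\<^sup>2) * (16 / (9 * \<sigma> * (n - 1))))"
      using order_trans[OF bound[OF k(1)] mult_left_mono[OF nn_integral_leading_row_ratio_other[OF \<sigma> k(2) assms(2) mean_row]]]
      by (simp add: n_def)
    also have "\<dots> = ennreal (sqrt (2 / pi) / (\<sigma> * x) * sqrt (?m k * (1 + ?m k * \<sigma>\<^sup>2))
        * (sqrt (1 + ?p k * \<sigma>\<^sup>2) * (16 / (9 * \<sigma> * (n - 1)))))"
      using \<sigma> x n by (intro ennreal_mult[symmetric]) auto
    also have "\<dots> \<le> ennreal (q * ?K * sqrt (?m k))"
    proof (rule ennreal_leI)
      have "sqrt ((1 + ?m k * \<sigma>\<^sup>2) * (1 + ?p k * \<sigma>\<^sup>2)) \<le> ((1 + ?m k * \<sigma>\<^sup>2) + (1 + ?p k * \<sigma>\<^sup>2)) / 2"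
        by (rule arith_geo_mean_sqrt) auto
      also have "\<dots> = 1 + (?m k + ?p k) * \<sigma>\<^sup>2 / 2"
        by (simp add: field_simps)
      also have "?m k + ?p k = n"
        unfolding n_def card_atLeast_lessThan[of k, symmetric] by simp
      finally have AMGM: "sqrt (1 + ?m k * \<sigma>\<^sup>2) * sqrt (1 + ?p k * \<sigma>\<^sup>2) \<le> 1 + n * \<sigma>\<^sup>2 / 2"
        by (simp add: real_sqrt_mult)
      let ?r = "q * sqrt (?m k) * (16 / (9 * \<sigma>\<^sup>2 * (n - 1)))"
      have "sqrt (2 / pi) / (\<sigma> * x) * sqrt (?m k * (1 + ?m k * \<sigma>\<^sup>2)) * (sqrt (1 + ?p k * \<sigma>\<^sup>2) * (16 / (9 * \<sigma> * (n - 1))))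
          = ?r * (sqrt (1 + ?m k * \<sigma>\<^sup>2) * sqrt (1 + ?p k * \<sigma>\<^sup>2))"
        by (simp add: q_def real_sqrt_mult power2_eq_square mult_ac)
      also have "\<dots> \<le> ?r * (1 + n * \<sigma>\<^sup>2 / 2)"
        using q n by (intro mult_left_mono AMGM) auto
      finally show "sqrt (2 / pi) / (\<sigma> * x) * sqrt (?m k * (1 + ?m k * \<sigma>\<^sup>2)) * (sqrt (1 + ?p k * \<sigma>\<^sup>2) * (16 / (9 * \<sigma> * (n - 1))))
          \<le> q * ?K * sqrt (?m k)"
        by (simp only: mult_ac)
    qed
    finally show ?thesis .
  qed

  have "?K \<ge> 0"
    using n by simp
  then have K: "q * ?K \<ge> 0"
    by (rule mult_nonneg_nonneg[OF less_imp_le[OF q]])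
  have "emeasure M {\<omega> \<in> space M. growth_factor (A \<omega>) > 1 + x}
      = emeasure (distr M borel A) {A. growth_factor A > 1 + x}"
    by (subst emeasure_distr) (auto intro!: arg_cong[where f="emeasure M"])
  also have "\<dots> = emeasure ?\<gamma> {A. growth_factor A > 1 + x}"
    by (simp add: distr_gaussian_perturbation(2)[OF assms(1,4,6)])
  also have "\<dots> \<le> emeasure ?\<gamma> (\<Union>k\<in>UNIV. ?E k)"
    using growth_factor_gt[OF _ x, where l=l] by (intro emeasure_mono) auto
  also have "\<dots> \<le> (\<Sum>k\<in>UNIV. emeasure ?\<gamma> (?E k))"
    by (rule emeasure_subadditive_finite) auto
  also have "\<dots> = (\<Sum>k\<in>UNIV - {l, p}. emeasure ?\<gamma> (?E k)) + (\<Sum>k\<in>{l, p}. emeasure ?\<gamma> (?E k))"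
    by (rule sum.subset_diff) auto
  also have "(\<Sum>k\<in>{l, p}. emeasure ?\<gamma> (?E k)) = emeasure ?\<gamma> (?E l)"
    using \<open>p < l\<close> first by simp
  also have "(\<Sum>k\<in>UNIV - {l, p}. emeasure ?\<gamma> (?E k)) + emeasure ?\<gamma> (?E l)
      \<le> (\<Sum>k\<in>UNIV - {l, p}. ennreal (q * ?K * sqrt (?m k))) + ennreal (q * (n / \<sigma>))"
    by (intro add_mono sum_mono middle last)
  also have "\<dots> = ennreal ((\<Sum>k\<in>UNIV - {l, p}. q * ?K * sqrt (?m k)) + q * (n / \<sigma>))"
  proof -
    have "0 \<le> q * ?K * sqrt (?m k)" for k
      by (rule mult_nonneg_nonneg[OF K]) simp
    then show ?thesis
      using q n \<sigma> by (subst sum_ennreal) (auto intro!: ennreal_plus[symmetric] sum_nonneg)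
  qed
  also have "\<dots> \<le> ennreal (q * (2 / 3 * n powr (3 / 2) + n / \<sigma> + 4 / 3 * (sqrt n / \<sigma>\<^sup>2)))"
  proof (rule ennreal_leI)
    have "(\<Sum>k\<in>UNIV - {l, p}. q * ?K * sqrt (?m k)) = q * ?K * (\<Sum>k\<in>UNIV - {l, p}. sqrt (?m k))"
      by (rule sum_distrib_left[symmetric])
    also have "\<dots> \<le> q * ?K * (3 / 4 * (n - 1) * sqrt n)"
      unfolding n_def using K[unfolded n_def] by (rule mult_left_mono[OF sum_sqrt_card_atLeast_le[OF l p]])
    \<comment> \<open>The factor n - 1 cancels and 16/9 times 3/4 is 4/3. The summand 1 of
      \<open>?K\<close> gives the term with \<open>\<sigma>\<^sup>2\<close> in the denominator; the
      summand \<open>n * \<sigma>\<^sup>2 / 2\<close> gives 2/3 of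
      \<open>n * sqrt n\<close>.\<close>
    also have "\<dots> = q * (2 / 3 * (n * sqrt n) + 4 / 3 * (sqrt n / \<sigma>\<^sup>2))"
      using n \<sigma> by (simp add: field_simps)
    also have "n * sqrt n = n powr (3 / 2)"
    proof -
      have "n powr (3 / 2) = n powr (1 + 1 / 2)"
        by simp
      also have "\<dots> = n * sqrt n"
        unfolding powr_add using n by (simp add: powr_half_sqrt)
      finally show ?thesis ..
    qed
    finally show "(\<Sum>k\<in>UNIV - {l, p}. q * ?K * sqrt (?m k)) + q * (n / \<sigma>)
        \<le> q * (2 / 3 * n powr (3 / 2) + n / \<sigma> + 4 / 3 * (sqrt n / \<sigma>\<^sup>2))"
      by (simp add: distrib_left)
  qed
  finally have "emeasure M {\<omega> \<in> space M. growth_factor (A \<omega>) > 1 + x}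
      \<le> ennreal (q * (2 / 3 * n powr (3 / 2) + n / \<sigma> + 4 / 3 * (sqrt n / \<sigma>\<^sup>2)))" .
  moreover have "0 \<le> q * (2 / 3 * n powr (3 / 2) + n / \<sigma> + 4 / 3 * (sqrt n / \<sigma>\<^sup>2))"
    using q n \<sigma> by (intro mult_nonneg_nonneg) (auto intro!: add_nonneg_nonneg)
  ultimately show "measure M {\<omega> \<in> space M. growth_factor (A \<omega>) > 1 + x} \<le>
      sqrt (2 / pi) * (1 / x) *
        (2 / 3 * real CARD('n) powr (3 / 2) + real CARD('n) / \<sigma>
          + 4 / 3 * (sqrt (real CARD('n)) / \<sigma>\<^sup>2))"
    by (simp add: emeasure_eq_measure q_def n_def)
qed

end
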